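(* For every integer $n\geq 1$, $$\sum_{\sigma \in S_n(321)}q^{\mathrm{cr}(\sigma)}=\sum_{\sigma \in S_n(132)}q^{\mathrm{cr}(\sigma)}=\sum_{\sigma \in S_n(213)}q^{\mathrm{cr}(\sigma)}.$$
   Context: $S_n$ is the set of permutations of $[n]=\{1,\ldots,n\}$, written in one-line notation $\sigma=\sigma(1)\cdots\sigma(n)$. For a pattern $\tau\in S_m$, $S_n(\tau)$ is the set of $\sigma\in S_n$ avoiding $\tau$, i.e. having no subsequence $\sigma(i_1)\cdots\sigma(i_m)$ with $i_1<\cdots<i_m$ whose entries are in the same relative order as $\tau(1)\cdots\tau(m)$. A crossing of $\sigma\in S_n$ is a pair $(i,j)$ of elements of $[n]$ with $i<j<\sigma(i)<\sigma(j)$ or $\sigma(i)<\sigma(j)\leq i<j$; $\mathrm{cr}(\sigma)$ is the number of crossings of $\sigma$. *)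

theory Defs
  imports
    "HOL-Combinatorics.Permutations"
    "HOL-Computational_Algebra.Polynomial"
begin

text \<open>
  Elements of \<open>S\<^sub>n\<close> are functions \<open>\<sigma>\<close> with \<open>\<sigma> permutes {1..n}\<close>, which extends them by
  the identity outside \<open>{1..n}\<close>. Patterns are given in one-line notation as lists, so that
  the list entry \<open>\<tau> ! k\<close> is the paper's \<open>\<tau>(k+1)\<close>; the map \<open>\<iota>\<close> below
  lists the positions of an occurrence, \<open>\<iota> k\<close> being \<open>i\<^bsub>k+1\<^esub>\<close>.
\<close>

definition contains_pattern :: "nat \<Rightarrow> (nat \<Rightarrow> nat) \<Rightarrow> nat list \<Rightarrow> bool" where
  "contains_pattern n \<sigma> \<tau> \<longleftrightarrow>
     (\<exists>\<iota>. \<iota> ` {..<length \<tau>} \<subseteq> {1..n} \<and> strict_mono_on {..<length \<tau>} \<iota> \<and>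
        (\<forall>a<length \<tau>. \<forall>b<length \<tau>. \<sigma> (\<iota> a) < \<sigma> (\<iota> b) \<longleftrightarrow> \<tau> ! a < \<tau> ! b))"

definition avoiders :: "nat \<Rightarrow> nat list \<Rightarrow> (nat \<Rightarrow> nat) set" where
  "avoiders n \<tau> = {\<sigma>. \<sigma> permutes {1..n} \<and> \<not> contains_pattern n \<sigma> \<tau>}"

definition crossings :: "nat \<Rightarrow> (nat \<Rightarrow> nat) \<Rightarrow> (nat \<times> nat) set" where
  "crossings n \<sigma> = {(i, j). i \<in> {1..n} \<and> j \<in> {1..n} \<and>
     (i < j \<and> j < \<sigma> i \<and> \<sigma> i < \<sigma> j \<or> \<sigma> i < \<sigma> j \<and> \<sigma> j \<le> i \<and> i < j)}"

definition cr :: "nat \<Rightarrow> (nat \<Rightarrow> nat) \<Rightarrow> nat" where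
  "cr n \<sigma> = card (crossings n \<sigma>)"

end

theory Submission
  imports Defs "HOL-Library.Infinite_Set"
begin

text \<open>
  Both generating functions equal the sum over Dyck paths of length \<open>2n\<close> of
  \<open>q\<close> to the sum of \<open>(h - 1) / 2\<close> over the heights \<open>h\<close> at odd times;
  \<open>transfer\<close> below is the transfer-matrix recursion for that sum.

  For a 321-avoiding \<open>\<sigma>\<close> the path records, for \<open>k = 1, \<dots>, n\<close>, first whether the value
  \<open>k\<close> and then whether the position \<open>k\<close> belongs to an excedance: \<open>\<sigma>\<close> is increasing on
  excedances and on the other positions, and so is determined by the path.

  A 132-avoiding \<open>\<sigma> = A n B\<close> has all entries of \<open>A\<close> above those of \<open>B\<close>, so it is a binary
  tree and, via \<open>U A D B\<close>, a Dyck word \<open>w\<close>. The letters of \<open>w\<close> are then deleted from the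
  outside inwards, alternately at the right and at the left end. The number of unmatched
  letters of what remains takes the role of \<open>h\<close>, and it again changes by \<open>\<plusminus>1\<close> with one
  possibility for each sign. A matched pair of \<open>w\<close> is separated by exactly \<open>2 c + 1\<close> of the
  odd remainders, where \<open>c\<close> counts the crossings of the corresponding entry with smaller ones.

  Finally, inverse-reverse-complement preserves crossings and exchanges 132 with 213.
\<close>

subsection \<open>Words weighted by their unmatched letters\<close>

text \<open>Index \<open>a\<close> stands for the even height \<open>2 * a\<close>, and one
  unfolding covers two steps: through the odd height \<open>2 * a + 1\<close>, contributing
  \<open>a\<close>, or through \<open>2 * a - 1\<close>, contributing \<open>a - 1\<close>.\<close>

fun transfer :: "nat \<Rightarrow> nat \<Rightarrow> int poly" where
  "transfer 0 a = (if a = 0 then 1 else 0)"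
| "transfer (Suc n) a = monom 1 a * (transfer n a + transfer n (Suc a)) +
     (case a of 0 \<Rightarrow> 0 | Suc b \<Rightarrow> monom 1 b * (transfer n b + transfer n a))"

text \<open>
  \<open>True\<close> is the up-step \<open>U\<close> and \<open>False\<close> the down-step \<open>D\<close>; cancelling matched pairs
  leaves \<open>D\<close> repeated \<open>p\<close> times followed by \<open>U\<close> repeated \<open>s\<close> times, recorded as \<open>(p, s)\<close>.
\<close>

fun unmatched :: "bool list \<Rightarrow> nat \<times> nat" where
  "unmatched [] = (0, 0)"
| "unmatched (False # w) = (case unmatched w of (p, s) \<Rightarrow> (Suc p, s))"
| "unmatched (True # w) =
     (case unmatched w of (p, s) \<Rightarrow> (case p of 0 \<Rightarrow> (0, Suc s) | Suc p' \<Rightarrow> (p', s)))"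

text \<open>The \<open>U\<close>s left over in \<open>u\<close> cancel against the \<open>D\<close>s
  left over in \<open>v\<close>; truncated subtraction leaves the surplus on the side that has
  one.\<close>

lemma unmatched_append:
  "unmatched (u @ v) =
     (fst (unmatched u) + (fst (unmatched v) - snd (unmatched u)),
      snd (unmatched v) + (snd (unmatched u) - fst (unmatched v)))"
  by (induction u rule: unmatched.induct) (auto split: prod.splits nat.splits)

definition open_count :: "bool list \<Rightarrow> nat" where
  "open_count w = fst (unmatched w) + snd (unmatched w)"

definition factor :: "bool list \<Rightarrow> nat \<Rightarrow> nat \<Rightarrow> bool list" where
  "factor w l r = drop l (take r w)"

text \<open>For even length these windows are the odd remainders of the deletion, which starts at
  the right end: \<open>k\<close> letters are gone on the left and \<open>k + 1\<close> on the
  right.\<close>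

definition weight :: "bool list \<Rightarrow> nat" where
  "weight w = (\<Sum>k<length w div 2. (open_count (factor w k (length w - 1 - k)) - 1) div 2)"

definition words :: "nat \<Rightarrow> nat \<Rightarrow> nat \<Rightarrow> bool list set" where
  "words m p s = {w. length w = m \<and> unmatched w = (p, s)}"

lemma finite_words [simp]: "finite (words m p s)"
  by (rule finite_subset[OF _ finite_lists_length_eq[of UNIV m]]) (auto simp: words_def)

lemma parity_open_count: "even (open_count w) = even (length w)"
  by (induction w rule: unmatched.induct)
     (auto simp: open_count_def split: prod.splits nat.splits)

lemma weight_step:
  assumes "even (length v)"
  shows "weight (x # v @ [y]) = (open_count (x # v) - 1) div 2 + weight v"
proof -
  obtain m where m: "length v = 2 * m" using assms by (auto elim: evenE)
  have "factor (x # v @ [y]) (Suc k) (2 * m + 1 - Suc k) = factor v k (2 * m - 1 - k)"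
    if "k < m" for k
  proof -
    have "2 * m - k = Suc (2 * m - Suc k)" using that by simp
    then show ?thesis using that m by (simp add: factor_def)
  qed
  then show ?thesis
    unfolding weight_def using m
    by (simp add: sum.lessThan_Suc_shift del: sum.lessThan_Suc) (simp add: factor_def)
qed

lemma words_snoc:
  "words (Suc m) p s =
     (if s = 0 then {} else (\<lambda>w. w @ [True]) ` words m p (s - 1)) \<union>
     (\<lambda>w. w @ [False]) ` words m p (Suc s) \<union>
     (if s = 0 \<and> p > 0 then (\<lambda>w. w @ [False]) ` words m (p - 1) 0 else {})"
  (is "?L = ?R")
proof
  show "?L \<subseteq> ?R"
  proof
    fix w assume w: "w \<in> ?L"
    then obtain v y where vy: "w = v @ [y]"
      by (metis (mono_tags, lifting) words_def mem_Collect_eq length_Suc_conv_rev)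
    obtain p' s' where r: "unmatched v = (p', s')" by fastforce
    have "v \<in> words m p' s'" using w vy r by (auto simp: words_def)
    moreover have "(p, s) = unmatched (v @ [y])" using w vy by (auto simp: words_def)
    ultimately show "w \<in> ?R"
      using vy r by (cases y; cases s') (auto simp: unmatched_append split: if_splits)
  qed
  show "?R \<subseteq> ?L"
    by (auto simp: words_def unmatched_append split: if_splits)
qed

lemma words_Cons:
  "words (Suc m) p s =
     (if p = 0 then {} else (#) False ` words m (p - 1) s) \<union>
     (#) True ` words m (Suc p) s \<union>
     (if p = 0 \<and> s > 0 then (#) True ` words m 0 (s - 1) else {})"
  (is "?L = ?R")
proof
  show "?L \<subseteq> ?R"
  proof
    fix w assume w: "w \<in> ?L"
    then obtain v y where vy: "w = y # v"
      by (metis (mono_tags, lifting) words_def mem_Collect_eq length_Suc_conv)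
    obtain p' s' where r: "unmatched v = (p', s')" by fastforce
    have "v \<in> words m p' s'" using w vy r by (auto simp: words_def)
    moreover have "(p, s) = unmatched (y # v)" using w vy by (auto simp: words_def)
    ultimately show "w \<in> ?R"
      using vy r by (cases y; cases p') auto
  qed
  show "?R \<subseteq> ?L"
    by (auto simp: words_def split: if_splits)
qed

text \<open>Undoing the last letter leads to exactly one type with one more unmatched letter and, if
  \<open>p + s > 0\<close>, to exactly one with one fewer: the last letter was then an unmatched
  \<open>U\<close> if \<open>s > 0\<close> and an unmatched \<open>D\<close> otherwise. So
  \<open>p + s\<close> behaves like the height of a path.\<close>

lemma sum_words_snoc:
  "(\<Sum>w\<in>words (Suc m) p s. f (butlast w) :: int poly) =
     (\<Sum>w\<in>words m p (Suc s). f w) +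
     (if s > 0 then (\<Sum>w\<in>words m p (s - 1). f w)
      else if p > 0 then (\<Sum>w\<in>words m (p - 1) 0. f w) else 0)"
proof -
  have d: "(\<lambda>w. w @ [True]) ` X \<inter> (\<lambda>w. w @ [False]) ` Y = {}" for X Y
    by auto
  have d': "(\<lambda>w. w @ [False]) ` words m p s \<inter> (\<lambda>w. w @ [False]) ` words m p' s' = {}"
    if "s \<noteq> s'" for p s p' s'
    using that
    by (auto simp: words_def)
  have r: "(\<Sum>w\<in>(\<lambda>w. w @ [b]) ` X. f (butlast w)) = sum f X" for b X
    by (subst sum.reindex) (auto simp: inj_on_def)
  show ?thesis
    unfolding words_snoc
    by (cases "s = 0"; cases "p = 0") (auto simp: sum.union_disjoint d d' r)
qed

text \<open>Mirror image of \<open>sum_words_snoc\<close>, with \<open>p\<close> and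
  \<open>s\<close> exchanging roles.\<close>

lemma sum_words_Cons:
  "(\<Sum>w\<in>words (Suc m) p s. f (tl w) :: int poly) =
     (\<Sum>w\<in>words m (Suc p) s. f w) +
     (if p > 0 then (\<Sum>w\<in>words m (p - 1) s. f w)
      else if s > 0 then (\<Sum>w\<in>words m 0 (s - 1). f w) else 0)"
proof -
  have d: "(#) False ` X \<inter> (#) True ` Y = {}" for X Y
    by auto
  have d': "(#) True ` words m p s \<inter> (#) True ` words m p' s' = {}"
    if "p \<noteq> p'" for p s p' s'
    using that
    by (auto simp: words_def)
  have r: "(\<Sum>w\<in>(#) b ` X. f (tl w)) = sum f X" for b X
    by (subst sum.reindex) (auto simp: inj_on_def)
  show ?thesis
    unfolding words_Cons
    by (cases "p = 0"; cases "s = 0") (auto simp: sum.union_disjoint d d' r)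
qed

text \<open>The sum depends on \<open>p\<close> and \<open>s\<close> only through the height
  \<open>p + s\<close>. Deleting the last letter and then the first one is one step of
  \<open>transfer\<close>.\<close>

lemma sum_words_weight:
  "p + s = 2 * a \<Longrightarrow> (\<Sum>w\<in>words (2 * m) p s. monom 1 (weight w)) = transfer m a"
proof (induction m arbitrary: p s a)
  case 0
  have "words 0 p s = (if p = 0 \<and> s = 0 then {[]} else {})"
    by (auto simp: words_def)
  then show ?case using 0 by (auto simp: weight_def monom_0)
next
  case (Suc m)
  \<comment> \<open>\<open>f\<close> weighs a remainder of odd length: its own contribution and that
    of the windows inside it. In \<open>odd_sum\<close> all words have \<open>2 * b + 1\<close>
    unmatched letters, so the factor \<open>monom 1 b\<close> comes out.\<close>
  define f where "f w = monom (1::int) ((open_count w - 1) div 2 + weight (tl w))" for w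
  have odd_sum: "(\<Sum>w\<in>words (Suc (2 * m)) p s. f w) =
      monom 1 b * (transfer m b + transfer m (Suc b))" if ps: "p + s = Suc (2 * b)" for p s b
  proof -
    have "(\<Sum>w\<in>words (Suc (2 * m)) p s. f w) =
        monom 1 b * (\<Sum>w\<in>words (Suc (2 * m)) p s. monom 1 (weight (tl w)))"
      unfolding sum_distrib_left
      by (rule sum.cong) (use ps in \<open>auto simp: f_def words_def open_count_def mult_monom\<close>)
    also have "(\<Sum>w\<in>words (Suc (2 * m)) p s. monom 1 (weight (tl w))) =
        transfer m b + transfer m (Suc b)"
      unfolding sum_words_Cons[where f = "\<lambda>w. monom 1 (weight w)"] using ps
      by (auto simp: Suc.IH[where a = b] Suc.IH[where a = "Suc b"])
    finally show ?thesis .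
  qed
  have "(\<Sum>w\<in>words (2 * Suc m) p s. monom 1 (weight w)) =
      (\<Sum>w\<in>words (Suc (Suc (2 * m))) p s. f (butlast w))"
  proof (rule sum.cong)
    fix w assume "w \<in> words (Suc (Suc (2 * m))) p s"
    then have len: "length w = Suc (Suc (2 * m))" by (auto simp: words_def)
    then obtain v y where vy: "w = v @ [y]" "length v = Suc (2 * m)"
      by (metis length_Suc_conv_rev)
    then obtain x u where xu: "v = x # u" "length u = 2 * m"
      by (metis length_Suc_conv)
    show "monom 1 (weight w) = f (butlast w)"
      using vy xu by (simp add: f_def weight_step)
  qed simp
  also have "\<dots> = transfer (Suc m) a"
  proof (cases a)
    case 0
    then show ?thesis unfolding sum_words_snoc[where f = f] using Suc.prems by (simp add: odd_sum[where b = 0])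
  next
    case (Suc b)
    then show ?thesis unfolding sum_words_snoc[where f = f] using Suc.prems
      by (auto simp: odd_sum[where b = b] odd_sum[where b = "Suc b"])
  qed
  finally show ?case .
qed

subsection \<open>Binary trees as Dyck words\<close>

datatype bintree = Leaf | Node bintree bintree

primrec nodes :: "bintree \<Rightarrow> nat" where
  "nodes Leaf = 0"
| "nodes (Node A B) = Suc (nodes A + nodes B)"

primrec word :: "bintree \<Rightarrow> bool list" where
  "word Leaf = []"
| "word (Node A B) = True # word A @ False # word B"

lemma length_word: "length (word t) = 2 * nodes t"
  by (induction t) auto

lemma unmatched_word: "unmatched (word t) = (0, 0)"
  by (induction t) (simp_all add: unmatched_append)

text \<open>The \<open>False\<close> after \<open>word A\<close> is the first unmatched
  \<open>D\<close> of the string, so the end of \<open>word A\<close> can be recognised from the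
  left.\<close>

lemma word_append_cancel:
  "word A @ False # x = word A' @ False # y \<Longrightarrow> A = A' \<and> x = y"
proof (induction A arbitrary: A' x y)
  case Leaf
  then show ?case by (cases A') auto
next
  case (Node A1 A2)
  from Node.prems obtain B1 B2 where B: "A' = Node B1 B2"
    by (cases A') auto
  from Node.prems[unfolded B] have "A1 = B1 \<and> word A2 @ False # x = word B2 @ False # y"
    using Node.IH(1)[of "word A2 @ False # x" B1 "word B2 @ False # y"] by simp
  then show ?case using Node.IH(2) B by blast
qed

lemma inj_word: "inj word"
  by (metis injI word_append_cancel)

text \<open>The two claims feed each other. After an initial \<open>U\<close>, the first claim
  applied to the tail splits off the left subtree up to the matching \<open>D\<close>; what follows
  is shorter and has the same counts as \<open>w\<close>, so the induction hypothesis for it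
  supplies the right subtree.\<close>

lemma unmatched_parse:
  "(fst (unmatched w) > 0 \<longrightarrow> (\<exists>t v. w = word t @ False # v \<and>
      unmatched v = (fst (unmatched w) - 1, snd (unmatched w)))) \<and>
   (unmatched w = (0, 0) \<longrightarrow> (\<exists>t. w = word t))"
proof (induction "length w" arbitrary: w rule: less_induct)
  case less
  show ?case
  proof (cases w)
    case Nil
    then show ?thesis by (auto intro: exI[of _ Leaf])
  next
    case (Cons x v)
    obtain p s where r: "unmatched v = (p, s)" by fastforce
    show ?thesis
    proof (cases x)
      case False
      then show ?thesis using Cons r by (auto intro!: exI[of _ Leaf])
    next
      case True
      show ?thesis
      proof (cases p)
        case 0
        then show ?thesis using Cons r True by auto
      next
        case (Suc p')
        then obtain A v' where A: "v = word A @ False # v'" "unmatched v' = (p', s)"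
          using less[of v] Cons r by auto
        have w: "unmatched w = (p', s)" using Cons True r Suc by auto
        have *: "w = word (Node A B) @ z" if "v' = word B @ z" for B z
          using Cons True A that by simp
        have "length v' < length w" using Cons A by simp
        from less[OF this] show ?thesis
          unfolding w A(2) using *[where z = "[]"] * by (metis append_Nil2 fst_conv snd_conv)
      qed
    qed
  qed
qed

lemma bij_betw_word: "bij_betw word {t. nodes t = n} (words (2 * n) 0 0)"
proof -
  have "\<exists>t. nodes t = n \<and> word t = w" if "w \<in> words (2 * n) 0 0" for w
    using that unmatched_parse[of w] length_word by (fastforce simp: words_def)
  then show ?thesis
    unfolding bij_betw_def
    by (auto simp: words_def length_word unmatched_word image_iff intro: inj_on_subset[OF inj_word])
qed

text \<open>Number of matched pairs of \<open>word t\<close> with exactly one letter at positions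
  \<open>l\<close>, ..., \<open>r - 1\<close>. The root's pair sits at positions \<open>0\<close>
  and \<open>Suc (2 * nodes A)\<close>; truncated subtraction clips the window to each
  subword.\<close>

primrec cut :: "bintree \<Rightarrow> nat \<Rightarrow> nat \<Rightarrow> nat" where
  "cut Leaf l r = 0"
| "cut (Node A B) l r =
     of_bool ((l \<le> 0 \<and> 0 < r) \<noteq> (l \<le> Suc (2 * nodes A) \<and> Suc (2 * nodes A) < r)) +
     cut A (l - 1) (r - 1) + cut B (l - 2 - 2 * nodes A) (r - 2 - 2 * nodes A)"

lemma factor_append:
  "factor (u @ v) l r = factor u l r @ factor v (l - length u) (r - length u)"
proof (cases "r \<le> length u")
  case False
  then show ?thesis by (simp add: factor_def drop_take)
qed (simp add: factor_def)

lemma factor_single: "factor [x] l r = (if l \<le> 0 \<and> 0 < r then [x] else [])"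
  by (cases r; cases l) (auto simp: factor_def)

text \<open>An unmatched \<open>D\<close> of a prefix stays unmatched whatever follows, and
  \<open>word t\<close> has none.\<close>

lemma fst_unmatched_prefix: "fst (unmatched (factor (word t) 0 r)) = 0"
  using unmatched_append[of "take r (word t)" "drop r (word t)"]
  by (simp add: unmatched_word factor_def)

lemma snd_unmatched_suffix:
  "r \<ge> 2 * nodes t \<Longrightarrow> snd (unmatched (factor (word t) l r)) = 0"
  using unmatched_append[of "take l (word t)" "drop l (word t)"]
  by (simp add: unmatched_word factor_def length_word)

lemma factor_empty: "l \<ge> length w \<Longrightarrow> factor w l r = []" "factor w l 0 = []"
  by (auto simp: factor_def)

text \<open>A letter of the factor is unmatched exactly when its partner in \<open>word t\<close>
  lies outside the window.\<close>

lemma open_count_factor_word: "open_count (factor (word t) l r) = cut t l r"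
proof (induction t arbitrary: l r)
  case Leaf
  then show ?case by (simp add: factor_def open_count_def)
next
  case (Node A B)
  define a where "a = 2 * nodes A"
  define fA where "fA = factor (word A) (l - 1) (r - 1)"
  define fB where "fB = factor (word B) (l - 2 - a) (r - 2 - a)"
  define U where "U = (if l \<le> 0 \<and> 0 < r then [True] else [])"
  define D where "D = (if l - 1 - a \<le> 0 \<and> 0 < r - 1 - a then [False] else [])"
  have cA: "cut A (l - 1) (r - 1) = open_count fA"
    and cB: "cut B (l - 2 - a) (r - 2 - a) = open_count fB"
    by (simp_all add: Node.IH fA_def fB_def)
  have "word (Node A B) = [True] @ word A @ [False] @ word B" by simp
  then have fac: "factor (word (Node A B)) l r = U @ fA @ D @ fB"
    unfolding fA_def fB_def a_def U_def D_def
    by (simp only: factor_append factor_single length_word list.size) simp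
  \<comment> \<open>A window reaching past \<open>word A\<close> cuts out a suffix, without
    unmatched \<open>U\<close>; one starting no later than a subword cuts out a prefix, without
    unmatched \<open>D\<close>. Hence nothing cancels across the pieces except the root's own
    pair.\<close>
  have sA: "snd (unmatched fA) = 0" if "r \<ge> Suc a"
    unfolding fA_def by (rule snd_unmatched_suffix) (use that in \<open>auto simp: a_def\<close>)
  have pA: "fst (unmatched fA) = 0" if "l \<le> 1"
    using that fst_unmatched_prefix by (simp add: fA_def)
  have pB: "fst (unmatched fB) = 0" if "l \<le> Suc (Suc a)"
    using that fst_unmatched_prefix by (simp add: fB_def)
  have eA: "fA = []" if "l \<ge> Suc a \<or> r = 0"
    using that by (auto simp: fA_def factor_empty length_word a_def)
  have eB: "fB = []" if "r \<le> Suc (Suc a)"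
    using that by (auto simp: fB_def factor_empty)
  have cut: "cut (Node A B) l r =
      of_bool ((l \<le> 0 \<and> 0 < r) \<noteq> (l \<le> Suc a \<and> Suc a < r)) + open_count fA + open_count fB"
    using cA cB by (simp add: a_def)
  \<comment> \<open>The window contains both letters of the root, only its \<open>U\<close>,
    nothing, only its \<open>D\<close>, or neither, then ending before the \<open>D\<close> or
    starting after it.\<close>
  consider "l \<le> 0" "Suc a < r" | "l \<le> 0" "0 < r" "r \<le> Suc a" | "r = 0"
    | "l > 0" "l \<le> Suc a" "Suc a < r" | "l > 0" "r \<le> Suc a" | "l > Suc a" 
    by linarith
  then have "open_count (U @ fA @ D @ fB) =
      of_bool ((l \<le> 0 \<and> 0 < r) \<noteq> (l \<le> Suc a \<and> Suc a < r)) + open_count fA + open_count fB"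
  proof cases
    case 1
    then show ?thesis
      using sA pA pB
      by (cases "unmatched fB") (simp add: U_def D_def unmatched_append open_count_def)
  next
    case 2
    then show ?thesis
      using pA eB
      by (cases "unmatched fA") (simp add: U_def D_def unmatched_append open_count_def)
  next
    case 3
    then show ?thesis
      using eA eB by (simp add: U_def D_def unmatched_append open_count_def)
  next
    case 4
    then show ?thesis
      using sA pB
      by (cases "unmatched fB") (simp add: U_def D_def unmatched_append open_count_def)
  next
    case 5
    then show ?thesis
      using eB by (simp add: U_def D_def unmatched_append open_count_def)
  next
    case 6
    then show ?thesis
      using eA by (simp add: U_def D_def unmatched_append open_count_def)
  qed
  then show ?case unfolding fac cut .
qed

text \<open>The windows have odd length, hence odd open count, so every halving in
  \<open>weight\<close> is exact and each window adds 1 to the left side.\<close>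

lemma weight_word:
  assumes "nodes t = n"
  shows "2 * weight (word t) + n = (\<Sum>k<n. cut t k (2 * n - 1 - k))"
proof -
  have odd: "odd (cut t k (2 * n - 1 - k))" if "k < n" for k
  proof -
    have "length (factor (word t) k (2 * n - 1 - k)) = 2 * (n - 1 - k) + 1"
      using that assms by (auto simp: factor_def length_word)
    then show ?thesis
      using parity_open_count[of "factor (word t) k (2 * n - 1 - k)"]
      by (simp add: open_count_factor_word)
  qed
  have "2 * weight (word t) + n = (\<Sum>k<n. 2 * ((cut t k (2 * n - 1 - k) - 1) div 2) + 1)"
    unfolding sum.distrib using assms
    by (simp add: weight_def length_word open_count_factor_word sum_distrib_left)
  also have "\<dots> = (\<Sum>k<n. cut t k (2 * n - 1 - k))"
    by (rule sum.cong) (use odd in \<open>auto elim!: oddE\<close>)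
  finally show ?thesis .
qed

subsection \<open>Binary trees as 132-avoiding permutation matrices\<close>

text \<open>Pairs are (position, value), and the root carries the largest value. Absolute offsets
  \<open>a\<close> and \<open>b\<close> are kept because crossings compare positions with
  values.\<close>

primrec points :: "bintree \<Rightarrow> nat \<Rightarrow> nat \<Rightarrow> (nat \<times> nat) set" where
  "points Leaf a b = {}"
| "points (Node A B) a b =
     insert (Suc (a + nodes A), Suc (b + nodes A + nodes B))
       (points A a (b + nodes B) \<union> points B (Suc (a + nodes A)) b)"

definition cross :: "nat \<times> nat \<Rightarrow> nat \<times> nat \<Rightarrow> bool" where
  "cross P Q \<longleftrightarrow> fst P < fst Q \<and> snd P < snd Q \<and> (fst Q < snd P \<or> snd Q \<le> fst P)"

definition cross_count :: "(nat \<times> nat) set \<Rightarrow> nat" where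
  "cross_count S = card {(P, Q). P \<in> S \<and> Q \<in> S \<and> cross P Q}"

definition perm_matrix :: "nat \<Rightarrow> nat \<Rightarrow> nat \<Rightarrow> (nat \<times> nat) set \<Rightarrow> bool" where
  "perm_matrix m a b S \<longleftrightarrow> bij_betw fst S {a<..a + m} \<and> bij_betw snd S {b<..b + m}"

definition avoids_132 :: "(nat \<times> nat) set \<Rightarrow> bool" where
  "avoids_132 S \<longleftrightarrow> \<not> (\<exists>P\<in>S. \<exists>Q\<in>S. \<exists>R\<in>S.
     fst P < fst Q \<and> fst Q < fst R \<and> snd P < snd R \<and> snd R < snd Q)"

lemma perm_matrix_range:
  assumes "perm_matrix m a b S" "P \<in> S"
  shows "a < fst P" "fst P \<le> a + m" "b < snd P" "snd P \<le> b + m"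
  using assms by (auto simp: perm_matrix_def dest!: bij_betw_imp_surj_on)

lemma perm_matrix_points: "perm_matrix (nodes t) a b (points t a b)"
proof (induction t arbitrary: a b)
  case (Node A B)
  define R where "R = (Suc (a + nodes A), Suc (b + nodes A + nodes B))"
  have pA: "perm_matrix (nodes A) a (b + nodes B) (points A a (b + nodes B))"
    and pB: "perm_matrix (nodes B) (Suc (a + nodes A)) b (points B (Suc (a + nodes A)) b)"
    using Node.IH by auto
  have "bij_betw fst (points A a (b + nodes B) \<union> points B (Suc (a + nodes A)) b \<union> {R})
      ({a<..a + nodes A} \<union> {Suc (a + nodes A)<..Suc (a + nodes A) + nodes B} \<union> {fst R})"
    by (intro bij_betw_combine) (use pA pB in \<open>auto simp: perm_matrix_def R_def\<close>)
  moreover have "{a<..a + nodes A} \<union> {Suc (a + nodes A)<..Suc (a + nodes A) + nodes B} \<union> {fst R} =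
      {a<..a + nodes (Node A B)}"
    by (auto simp: R_def)
  moreover have "bij_betw snd (points A a (b + nodes B) \<union> points B (Suc (a + nodes A)) b \<union> {R})
      ({b + nodes B<..b + nodes B + nodes A} \<union> {b<..b + nodes B} \<union> {snd R})"
    by (intro bij_betw_combine) (use pA pB in \<open>auto simp: perm_matrix_def R_def\<close>)
  moreover have "{b + nodes B<..b + nodes B + nodes A} \<union> {b<..b + nodes B} \<union> {snd R} =
      {b<..b + nodes (Node A B)}"
    by (auto simp: R_def)
  moreover have "points (Node A B) a b =
      points A a (b + nodes B) \<union> points B (Suc (a + nodes A)) b \<union> {R}"
    by (simp add: R_def)
  ultimately show ?case
    by (simp only: perm_matrix_def)
qed (simp add: perm_matrix_def bij_betw_def)

lemmas points_range = perm_matrix_range[OF perm_matrix_points]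

lemma finite_points [simp]: "finite (points t a b)"
  by (induction t arbitrary: a b) auto

text \<open>In an occurrence not inside one subtree the root could only be the 3, so the 1 lies in
  \<open>A\<close> and the 2 in \<open>B\<close>; but \<open>A\<close> lies above
  \<open>B\<close>.\<close>

lemma avoids_132_points: "avoids_132 (points t a b)"
proof (induction t arbitrary: a b)
  case (Node A B)
  let ?A = "points A a (b + nodes B)" and ?B = "points B (Suc (a + nodes A)) b"
  show ?case
    unfolding avoids_132_def
  proof (safe)
    fix p1 v1 p2 v2 p3 v3
    assume S: "(p1, v1) \<in> points (Node A B) a b" "(p2, v2) \<in> points (Node A B) a b"
        "(p3, v3) \<in> points (Node A B) a b"
      and o: "fst (p1, v1) < fst (p2, v2)" "fst (p2, v2) < fst (p3, v3)"
        "snd (p1, v1) < snd (p3, v3)" "snd (p3, v3) < snd (p2, v2)"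
    have no: "\<not> ((p1, v1) \<in> C \<and> (p2, v2) \<in> C \<and> (p3, v3) \<in> C)" if "avoids_132 C" for C
      using that o unfolding avoids_132_def by blast
    show False
      using S o no[OF Node.IH(1)[of a "b + nodes B"]] no[OF Node.IH(2)[of "Suc (a + nodes A)" b]]
        points_range[of "(p1, v1)" A a "b + nodes B"] points_range[of "(p1, v1)" B "Suc (a + nodes A)" b]
        points_range[of "(p2, v2)" A a "b + nodes B"] points_range[of "(p2, v2)" B "Suc (a + nodes A)" b]
        points_range[of "(p3, v3)" A a "b + nodes B"] points_range[of "(p3, v3)" B "Suc (a + nodes A)" b]
      by auto
  qed
qed (simp add: avoids_132_def)

lemma nodes_eq_card: "nodes t = card (points t a b)"
  using bij_betw_same_card[of fst "points t a b"] perm_matrix_points[of t a b]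
  by (auto simp: perm_matrix_def)

text \<open>The largest value occurs only at the root, so its position gives the size of the left
  subtree; the subtrees are the points to the left and right of it.\<close>

lemma points_inject: "points t a b = points t' a b \<Longrightarrow> t = t'"
proof (induction t arbitrary: t' a b)
  case Leaf
  then show ?case by (cases t') auto
next
  case (Node A B)
  from Node.prems obtain A' B' where t': "t' = Node A' B'" by (cases t') auto
  have n: "nodes A + nodes B = nodes A' + nodes B'"
    using Node.prems nodes_eq_card[of "Node A B" a b] nodes_eq_card[of t' a b] t' by simp
  have "(Suc (a + nodes A), Suc (b + nodes A + nodes B)) \<in> points (Node A' B') a b"
    unfolding t'[symmetric] Node.prems[symmetric] by simp
  then have nA: "nodes A = nodes A'"
    using n points_range[of "(Suc (a + nodes A), Suc (b + nodes A + nodes B))" A' a "b + nodes B'"]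
      points_range[of "(Suc (a + nodes A), Suc (b + nodes A + nodes B))" B' "Suc (a + nodes A')" b]
    by auto
  then have nB: "nodes B = nodes B'" using n by simp
  have split: "points A a (b + nodes B) = {P \<in> points (Node A B) a b. fst P < Suc (a + nodes A)}"
    "points B (Suc (a + nodes A)) b = {P \<in> points (Node A B) a b. fst P > Suc (a + nodes A)}" for A B
    using points_range[of _ A a "b + nodes B"] points_range[of _ B "Suc (a + nodes A)" b]
    by fastforce+
  have "points A a (b + nodes B) = points A' a (b + nodes B)"
    using split(1)[of A B] split(1)[of A' B'] Node.prems unfolding t' nA nB by presburger
  moreover have "points B (Suc (a + nodes A)) b = points B' (Suc (a + nodes A)) b"
    using split(2)[where A = A and B = B] split(2)[where A = A' and B = B'] Node.prems unfolding t' nA nB by presburger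
  ultimately show ?case using Node.IH t' by blast
qed

text \<open>A number above \<open>c\<close> and at most \<open>Max Y\<close> cannot belong to
  \<open>X\<close>, so \<open>Y\<close> is an initial segment whose length is its
  cardinality.\<close>

lemma interval_split:
  fixes X Y :: "nat set"
  assumes un: "X \<union> Y = {c<..c + l + k}" and lt: "\<And>x y. x \<in> X \<Longrightarrow> y \<in> Y \<Longrightarrow> y < x"
    and card: "card Y = l"
  shows "Y = {c<..c + l}" "X = {c + l<..c + l + k}"
proof -
  have fin: "finite Y" using un by (metis finite_Un finite_greaterThanAtMost)
  show Y: "Y = {c<..c + l}"
  proof (cases "Y = {}")
    case False
    have "Y = {c<..Max Y}"
    proof (intro equalityI subsetI)
      fix z assume z: "z \<in> {c<..Max Y}"
      have "Max Y \<in> Y" using fin False by simp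
      then have "Max Y \<le> c + l + k" using un by auto
      then have "z \<in> X \<union> Y" using z un by auto
      then show "z \<in> Y" using lt[of z "Max Y"] \<open>Max Y \<in> Y\<close> z by auto
    qed (use fin un in auto)
    moreover have "card {c<..Max Y} = Max Y - c" by simp
    ultimately have "Max Y = c + l" using card False
      by (metis Nat.le_imp_diff_is_add add.commute bot_nat_0.not_eq_extremum card_gt_0_iff fin
          less_imp_le zero_less_diff)
    then show ?thesis using \<open>Y = {c<..Max Y}\<close> by simp
  qed (use card in auto)
  have "X \<inter> Y = {}" using lt by fastforce
  then have "X = {c<..c + l + k} - Y" using un by auto
  then show "X = {c + l<..c + l + k}" unfolding Y by auto
qed

text \<open>Splitting at the largest value \<open>b + m\<close> gives two smaller matrices:
  avoidance puts all values on its right below all values on its left, so both blocks occupy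
  intervals of positions and of values.\<close>

lemma points_surj:
  "perm_matrix m a b S \<Longrightarrow> avoids_132 S \<Longrightarrow> \<exists>t. nodes t = m \<and> points t a b = S"
proof (induction m arbitrary: a b S rule: less_induct)
  case (less m)
  have f: "inj_on fst S" "fst ` S = {a<..a + m}" and s: "inj_on snd S" "snd ` S = {b<..b + m}"
    using less.prems by (auto simp: perm_matrix_def bij_betw_def)
  show ?case
  proof (cases m)
    case 0
    then show ?thesis using f by (auto intro: exI[of _ Leaf])
  next
    case (Suc m')
    then have "b + m \<in> snd ` S" unfolding s by simp
    then obtain p where R: "(p, b + m) \<in> S" by auto
    define k where "k = p - a - 1"
    have p: "p = Suc (a + k)" "k \<le> m'"
      using perm_matrix_range[OF less.prems(1) R] Suc by (auto simp: k_def)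
    define l where "l = m' - k"
    have m: "m = Suc (l + k)" using p Suc by (simp add: l_def)
    define A where "A = {P \<in> S. fst P < p}"
    define B where "B = {P \<in> S. fst P > p}"
    have S: "S = insert (p, b + m) (A \<union> B)"
    proof -
      have "P = (p, b + m)" if "P \<in> S" "fst P = p" for P
        using inj_onD[OF f(1) _ that(1) R] that by simp
      then show ?thesis using R by (fastforce simp: A_def B_def)
    qed
    have lt: "snd P < b + m" if "P \<in> A \<union> B" for P
    proof -
      have "snd P \<noteq> b + m" using inj_onD[OF s(1), of P "(p, b + m)"] that R
        by (auto simp: A_def B_def)
      then show ?thesis using perm_matrix_range[OF less.prems(1), of P] that
        by (auto simp: A_def B_def)
    qed
    \<comment> \<open>Otherwise \<open>P\<close>, the maximum and \<open>Q\<close> form a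
      132.\<close>
    have BA: "snd Q < snd P" if "P \<in> A" "Q \<in> B" for P Q
    proof (rule ccontr)
      assume "\<not> snd Q < snd P"
      moreover have "snd P \<noteq> snd Q"
        using that inj_onD[OF s(1), of P Q] by (auto simp: A_def B_def)
      ultimately have "fst P < p \<and> p < fst Q \<and> snd P < snd Q \<and> snd Q < b + m"
        using that lt[of Q] by (auto simp: A_def B_def)
      then show False using less.prems(2) R that unfolding avoids_132_def A_def B_def
        by (metis (no_types, lifting) fst_conv mem_Collect_eq snd_conv)
    qed
    have fA: "fst ` A = {a<..a + k}"
    proof -
      have "fst ` A = {x \<in> fst ` S. x < p}" by (auto simp: A_def)
      then show ?thesis unfolding f using p m by auto
    qed
    have fB: "fst ` B = {Suc (a + k)<..Suc (a + k) + l}"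
    proof -
      have "fst ` B = {x \<in> fst ` S. x > p}" by (auto simp: B_def)
      then show ?thesis unfolding f using p m by auto
    qed
    have inj: "inj_on fst A" "inj_on fst B" "inj_on snd A" "inj_on snd B"
      using f(1) s(1) by (auto simp: A_def B_def inj_on_def)
    have "card (snd ` B) = l"
      using card_image[OF inj(4)] card_image[OF inj(2)] fB by simp
    moreover have "snd ` A \<union> snd ` B = {b<..b + l + k}"
    proof -
      have "snd ` A \<union> snd ` B = snd ` S - {b + m}"
        using S lt by force
      then show ?thesis unfolding s using m by auto
    qed
    ultimately have sB: "snd ` B = {b<..b + l}" and sA: "snd ` A = {b + l<..b + l + k}"
      using interval_split[of "snd ` A" "snd ` B" b l k] BA by (metis imageE)+
    have av: "avoids_132 A" "avoids_132 B"
      using less.prems(2) unfolding avoids_132_def A_def B_def by blast+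
    obtain tA where tA: "nodes tA = k" "points tA a (b + l) = A"
      using less.IH[of k a "b + l" A] m fA sA inj av by (auto simp: perm_matrix_def bij_betw_def)
    obtain tB where tB: "nodes tB = l" "points tB (Suc (a + k)) b = B"
      using less.IH[of l "Suc (a + k)" b B] m fB sB inj av
      by (auto simp: perm_matrix_def bij_betw_def)
    have "points (Node tA tB) a b = S"
      unfolding S using tA tB p m by (simp add: add.commute add.left_commute)
    then show ?thesis using tA tB m by (intro exI[of _ "Node tA tB"]) simp
  qed
qed

lemma bij_betw_points:
  "bij_betw (\<lambda>t. points t a b) {t. nodes t = m} {S. perm_matrix m a b S \<and> avoids_132 S}"
  unfolding bij_betw_def
proof
  show "inj_on (\<lambda>t. points t a b) {t. nodes t = m}"
    by (auto intro: inj_onI points_inject)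
  show "(\<lambda>t. points t a b) ` {t. nodes t = m} = {S. perm_matrix m a b S \<and> avoids_132 S}"
    using perm_matrix_points avoids_132_points points_surj by (fastforce simp: image_iff)
qed

section \<open>Crossings of the root and windows separating its letters\<close>

lemma card_filter_bij:
  assumes "bij_betw f A B"
  shows "card {x \<in> A. Q (f x)} = card {y \<in> B. Q y}"
proof -
  have "{y \<in> B. Q y} = f ` {x \<in> A. Q (f x)}"
    using assms by (auto simp: bij_betw_def)
  then show ?thesis
    using assms by (metis (no_types, lifting) bij_betw_def card_image inj_on_subset mem_Collect_eq subsetI)
qed

text \<open>\<open>A\<close> lies left of and above \<open>B\<close>, and the root has the largest
  value, so the only new crossings pair a point of \<open>A\<close> with the root. The two truncated
  differences count the upper ones, by value, and the lower ones, by position.\<close>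

lemma cross_count_Node:
  "cross_count (points (Node A B) a b) =
     cross_count (points A a (b + nodes B)) + cross_count (points B (Suc (a + nodes A)) b) +
     ((b + nodes B + nodes A - max (b + nodes B) (Suc (a + nodes A))) +
      (Suc (a + nodes A) - max (Suc a) (Suc (b + nodes A + nodes B))))"
proof -
  define R where "R = (Suc (a + nodes A), Suc (b + nodes A + nodes B))"
  define X where "X = points A a (b + nodes B)"
  define Y where "Y = points B (Suc (a + nodes A)) b"
  note rX = points_range[of _ A a "b + nodes B", folded X_def]
  note rY = points_range[of _ B "Suc (a + nodes A)" b, folded Y_def]
  have fin: "finite X" "finite Y" by (simp_all add: X_def Y_def)
  have pX: "perm_matrix (nodes A) a (b + nodes B) X"
    unfolding X_def by (rule perm_matrix_points)
  define pairs where "pairs S = {(P, Q). P \<in> S \<and> Q \<in> S \<and> cross P Q}" for S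
  have fp: "finite (pairs S)" if "finite S" for S
    by (rule finite_subset[of _ "S \<times> S"]) (use that in \<open>auto simp: pairs_def\<close>)
  define Z where "Z = (\<lambda>P. (P, R)) ` {P \<in> X. cross P R}"
  have "pairs (insert R (X \<union> Y)) = (pairs X \<union> pairs Y) \<union> Z"
  proof -
    have "\<not> cross P Q" if "P \<in> X" "Q \<in> Y" for P Q
      using rX[OF that(1)] rY[OF that(2)] by (auto simp: cross_def)
    moreover have "\<not> cross P Q" if "P \<in> Y" "Q \<in> X" for P Q
      using rX[OF that(2)] rY[OF that(1)] by (auto simp: cross_def)
    moreover have "\<not> cross R Q" if "Q \<in> X \<or> Q \<in> Y \<or> Q = R" for Q
      using rX[of Q] rY[of Q] that by (auto simp: cross_def R_def)
    moreover have "\<not> cross P R" if "P \<in> Y" for P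
      using rY[OF that] by (auto simp: cross_def R_def)
    ultimately show ?thesis unfolding pairs_def Z_def by blast
  qed
  moreover have "X \<inter> Y = {}" "R \<notin> X" "R \<notin> Y"
    using rX rY by (fastforce simp: R_def)+
  then have "pairs X \<inter> pairs Y = {}" "(pairs X \<union> pairs Y) \<inter> Z = {}"
    by (auto simp: pairs_def Z_def)
  moreover have "finite Z" using fin by (simp add: Z_def)
  ultimately have "card (pairs (insert R (X \<union> Y))) = card (pairs X) + card (pairs Y) + card Z"
    using fin fp by (simp add: card_Un_disjoint)
  moreover have "card Z = card {P \<in> X. cross P R}"
    unfolding Z_def by (rule card_image) (auto simp: inj_on_def)
  moreover have "card {P \<in> X. cross P R} =
      card {P \<in> X. Suc (a + nodes A) < snd P} + card {P \<in> X. Suc (b + nodes A + nodes B) \<le> fst P}"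
  proof -
    have "{P \<in> X. cross P R} = {P \<in> X. Suc (a + nodes A) < snd P} \<union>
        {P \<in> X. Suc (b + nodes A + nodes B) \<le> fst P}"
      using rX by (fastforce simp: cross_def R_def)
    moreover have "{P \<in> X. Suc (a + nodes A) < snd P} \<inter>
        {P \<in> X. Suc (b + nodes A + nodes B) \<le> fst P} = {}"
      using rX by fastforce
    ultimately show ?thesis using fin by (simp add: card_Un_disjoint)
  qed
  moreover have "card {P \<in> X. Suc (a + nodes A) < snd P} =
      b + nodes B + nodes A - max (b + nodes B) (Suc (a + nodes A))"
  proof -
    have "card {P \<in> X. Suc (a + nodes A) < snd P} =
        card {y \<in> {b + nodes B<..b + nodes B + nodes A}. Suc (a + nodes A) < y}"
      by (rule card_filter_bij) (use pX in \<open>simp add: perm_matrix_def\<close>)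
    also have "{y \<in> {b + nodes B<..b + nodes B + nodes A}. Suc (a + nodes A) < y} =
        {max (b + nodes B) (Suc (a + nodes A))<..b + nodes B + nodes A}" by auto
    finally show ?thesis by simp
  qed
  moreover have "card {P \<in> X. Suc (b + nodes A + nodes B) \<le> fst P} =
      Suc (a + nodes A) - max (Suc a) (Suc (b + nodes A + nodes B))"
  proof -
    have "card {P \<in> X. Suc (b + nodes A + nodes B) \<le> fst P} =
        card {y \<in> {a<..a + nodes A}. Suc (b + nodes A + nodes B) \<le> y}"
      by (rule card_filter_bij) (use pX in \<open>simp add: perm_matrix_def\<close>)
    also have "{y \<in> {a<..a + nodes A}. Suc (b + nodes A + nodes B) \<le> y} =
        {max (Suc a) (Suc (b + nodes A + nodes B))..a + nodes A}" by auto
    finally show ?thesis by simp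
  qed
  moreover have "points (Node A B) a b = insert R (X \<union> Y)" by (simp add: R_def X_def Y_def)
  ultimately show ?thesis
    unfolding cross_count_def X_def Y_def pairs_def by simp
qed

lemma card_sym_diff_lessThan:
  fixes e f n :: nat
  assumes "e \<le> n" "f \<le> n"
  shows "(\<Sum>k<n. of_bool ((k < e) \<noteq> (k < f)) :: nat) = max e f - min e f"
proof -
  have "(\<Sum>k<n. of_bool ((k < e) \<noteq> (k < f)) :: nat) = card {k \<in> {..<n}. (k < e) \<noteq> (k < f)}"
    by (subst sum_of_bool_eq) (auto simp: Int_def)
  also have "{k \<in> {..<n}. (k < e) \<noteq> (k < f)} = {min e f..<max e f}"
    using assms by auto
  finally show ?thesis by simp
qed

text \<open>
  Here \<open>x\<close> is the offset of the word of the subtree \<open>t\<close> in the whole word of length \<open>2 n\<close>,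
  and the first assumption is the relation that the recursion maintains between \<open>x\<close> and the
  offsets \<open>a\<close>, \<open>b\<close> of its points. The truncated subtractions intersect the window with the
  word of \<open>t\<close>.
\<close>

lemma sum_cut:
  assumes "x + b + nodes t = n + a" "x + 2 * nodes t \<le> 2 * n"
  shows "(\<Sum>k<n. cut t (k - x) (2 * n - 1 - k - x)) = 2 * cross_count (points t a b) + nodes t"
  using assms
proof (induction t arbitrary: x a b)
  case Leaf
  then show ?case by (simp add: cross_count_def)
next
  case (Node A B)
  \<comment> \<open>The windows are nested, and a letter at position \<open>x\<close> is in window
    \<open>k\<close> iff \<open>k \<le> x\<close> and \<open>x < 2 * n - 1 - k\<close>, that is, iff
    \<open>k < e\<close>. Likewise \<open>f\<close> belongs to the matching \<open>D\<close> at
    position \<open>y\<close>.\<close>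
  define e where "e = min (Suc x) (2 * n - 1 - x)"
  define y where "y = x + 1 + 2 * nodes A"
  define f where "f = min (Suc y) (2 * n - 1 - y)"
  have bounds: "e \<le> n" "f \<le> n" by (auto simp: e_def f_def)
  have IA: "(\<Sum>k<n. cut A (k - Suc x) (2 * n - 1 - k - Suc x)) =
      2 * cross_count (points A a (b + nodes B)) + nodes A"
    by (rule Node.IH(1)) (use Node.prems in auto)
  have IB: "(\<Sum>k<n. cut B (k - (Suc y)) (2 * n - 1 - k - Suc y)) =
      2 * cross_count (points B (Suc (a + nodes A)) b) + nodes B"
    by (rule Node.IH(2)) (use Node.prems in \<open>auto simp: y_def\<close>)
  have "(\<Sum>k<n. cut (Node A B) (k - x) (2 * n - 1 - k - x)) =
      (\<Sum>k<n. of_bool ((k < e) \<noteq> (k < f)) + cut A (k - Suc x) (2 * n - 1 - k - Suc x) +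
         cut B (k - (Suc y)) (2 * n - 1 - k - Suc y))"
  proof (rule sum.cong)
    fix k assume "k \<in> {..<n}"
    then have "k < n" by simp
    then have "(k - x \<le> 0 \<and> 0 < 2 * n - 1 - k - x) = (k < e)"
      unfolding e_def by linarith
    moreover have "(k - x \<le> Suc (2 * nodes A) \<and> Suc (2 * nodes A) < 2 * n - 1 - k - x) = (k < f)"
      unfolding f_def y_def by linarith
    moreover have "k - x - 1 = k - Suc x" "2 * n - 1 - k - x - 1 = 2 * n - 1 - k - Suc x"
      "k - x - 2 - 2 * nodes A = k - Suc y"
      "2 * n - 1 - k - x - 2 - 2 * nodes A = 2 * n - 1 - k - Suc y"
      by (auto simp: y_def)
    ultimately show "cut (Node A B) (k - x) (2 * n - 1 - k - x) =
      of_bool ((k < e) \<noteq> (k < f)) + cut A (k - Suc x) (2 * n - 1 - k - Suc x) +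
         cut B (k - (Suc y)) (2 * n - 1 - k - Suc y)"
      by (simp only: cut.simps)
  qed simp
  also have "\<dots> = (max e f - min e f) + (2 * cross_count (points A a (b + nodes B)) + nodes A) +
      (2 * cross_count (points B (Suc (a + nodes A)) b) + nodes B)"
    by (simp only: sum.distrib IA IB card_sym_diff_lessThan[OF bounds])
  \<comment> \<open>Let d be \<open>b + nodes B - a\<close> as an integer. The invariant makes
    \<open>e\<close> equal to n - abs (d + \<open>nodes A\<close>) and \<open>f\<close> equal to n -
    abs (\<open>nodes A\<close> + 1 - d). They differ by 2 c + 1, where c is min
    (\<open>nodes A\<close>) (d - 1) if d \<ge> 1 and min (\<open>nodes A\<close>) (-d) otherwise;
    this is the number of crossings with the root.\<close>
  also have "max e f - min e f =
     2 * ((b + nodes B + nodes A - max (b + nodes B) (Suc (a + nodes A))) +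
      (Suc (a + nodes A) - max (Suc a) (Suc (b + nodes A + nodes B)))) + 1"
    using Node.prems unfolding e_def f_def y_def max_def min_def nodes.simps
    by (auto split: if_splits)
  finally show ?case
    unfolding cross_count_Node by simp
qed

section \<open>Patterns of length three and graphs of permutations\<close>

lemma all_less_length_3:
  "(\<forall>a<length [x, y, z]. P a) \<longleftrightarrow> P 0 \<and> P (Suc 0) \<and> P (Suc (Suc 0))"
  by (auto simp: less_Suc_eq)

lemma contains_pattern_3:
  "contains_pattern n \<sigma> [x, y, z] \<longleftrightarrow>
     (\<exists>i\<in>{1..n}. \<exists>j\<in>{1..n}. \<exists>k\<in>{1..n}. i < j \<and> j < k \<and>
        (\<sigma> i < \<sigma> j \<longleftrightarrow> x < y) \<and> (\<sigma> j < \<sigma> i \<longleftrightarrow> y < x) \<and>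
        (\<sigma> i < \<sigma> k \<longleftrightarrow> x < z) \<and> (\<sigma> k < \<sigma> i \<longleftrightarrow> z < x) \<and>
        (\<sigma> j < \<sigma> k \<longleftrightarrow> y < z) \<and> (\<sigma> k < \<sigma> j \<longleftrightarrow> z < y))" (is "?L \<longleftrightarrow> ?R")
proof
  assume ?L
  then obtain \<iota> where \<iota>: "\<iota> ` {..<3} \<subseteq> {1..n}" "strict_mono_on {..<3} \<iota>"
    "\<forall>a<3. \<forall>b<3. \<sigma> (\<iota> a) < \<sigma> (\<iota> b) \<longleftrightarrow> [x, y, z] ! a < [x, y, z] ! b"
    by (auto simp: contains_pattern_def numeral_3_eq_3)
  have o: "\<iota> 0 < \<iota> 1" "\<iota> 1 < \<iota> 2"
    using \<iota>(2) by (auto simp: strict_mono_on_def)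
  have m: "\<iota> 0 \<in> {1..n}" "\<iota> 1 \<in> {1..n}" "\<iota> 2 \<in> {1..n}"
    using \<iota>(1) by (auto simp: image_subset_iff)
  have rel: "\<sigma> (\<iota> a) < \<sigma> (\<iota> b) \<longleftrightarrow> [x, y, z] ! a < [x, y, z] ! b" if "a < 3" "b < 3" for a b
    using \<iota>(3) that by blast
  have "\<sigma> (\<iota> 0) < \<sigma> (\<iota> 1) \<longleftrightarrow> x < y" "\<sigma> (\<iota> 1) < \<sigma> (\<iota> 0) \<longleftrightarrow> y < x"
    "\<sigma> (\<iota> 0) < \<sigma> (\<iota> 2) \<longleftrightarrow> x < z" "\<sigma> (\<iota> 2) < \<sigma> (\<iota> 0) \<longleftrightarrow> z < x"
    "\<sigma> (\<iota> 1) < \<sigma> (\<iota> 2) \<longleftrightarrow> y < z" "\<sigma> (\<iota> 2) < \<sigma> (\<iota> 1) \<longleftrightarrow> z < y"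
    using rel[of 0 1] rel[of 1 0] rel[of 0 2] rel[of 2 0] rel[of 1 2] rel[of 2 1]
    by simp_all
  then show ?R using o m by blast
next
  assume ?R
  then obtain i j k where m: "i \<in> {1..n}" "j \<in> {1..n}" "k \<in> {1..n}" and o: "i < j" "j < k"
    and rel: "\<sigma> i < \<sigma> j \<longleftrightarrow> x < y" "\<sigma> j < \<sigma> i \<longleftrightarrow> y < x" "\<sigma> i < \<sigma> k \<longleftrightarrow> x < z"
    "\<sigma> k < \<sigma> i \<longleftrightarrow> z < x" "\<sigma> j < \<sigma> k \<longleftrightarrow> y < z" "\<sigma> k < \<sigma> j \<longleftrightarrow> z < y"
    by blast
  define \<iota> where "\<iota> a = (if a = 0 then i else if a = 1 then j else k)" for a :: nat
  have "\<iota> ` {..<length [x, y, z]} \<subseteq> {1..n}"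
    using m by (auto simp: \<iota>_def)
  moreover have "strict_mono_on {..<length [x, y, z]} \<iota>"
    using o by (intro strict_mono_onI) (auto simp: \<iota>_def less_Suc_eq)
  moreover have "\<forall>a<length [x, y, z]. \<forall>b<length [x, y, z].
      \<sigma> (\<iota> a) < \<sigma> (\<iota> b) \<longleftrightarrow> [x, y, z] ! a < [x, y, z] ! b"
    unfolding all_less_length_3 by (simp add: \<iota>_def rel)
  ultimately show ?L
    unfolding contains_pattern_def by blast
qed

lemma avoiders_321:
  "\<sigma> \<in> avoiders n [3, 2, 1] \<longleftrightarrow> \<sigma> permutes {1..n} \<and>
     \<not> (\<exists>i\<in>{1..n}. \<exists>j\<in>{1..n}. \<exists>k\<in>{1..n}. i < j \<and> j < k \<and> \<sigma> k < \<sigma> j \<and> \<sigma> j < \<sigma> i)"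
  unfolding avoiders_def contains_pattern_3 mem_Collect_eq
  by (rule conj_cong[OF refl], rule arg_cong[where f = Not], (rule bex_cong[OF refl])+) auto

lemma avoiders_132:
  "\<sigma> \<in> avoiders n [1, 3, 2] \<longleftrightarrow> \<sigma> permutes {1..n} \<and>
     \<not> (\<exists>i\<in>{1..n}. \<exists>j\<in>{1..n}. \<exists>k\<in>{1..n}. i < j \<and> j < k \<and> \<sigma> i < \<sigma> k \<and> \<sigma> k < \<sigma> j)"
  unfolding avoiders_def contains_pattern_3 mem_Collect_eq
  by (rule conj_cong[OF refl], rule arg_cong[where f = Not], (rule bex_cong[OF refl])+) auto

lemma avoiders_213:
  "\<sigma> \<in> avoiders n [2, 1, 3] \<longleftrightarrow> \<sigma> permutes {1..n} \<and>
     \<not> (\<exists>i\<in>{1..n}. \<exists>j\<in>{1..n}. \<exists>k\<in>{1..n}. i < j \<and> j < k \<and> \<sigma> j < \<sigma> i \<and> \<sigma> i < \<sigma> k)"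
  unfolding avoiders_def contains_pattern_3 mem_Collect_eq
  by (rule conj_cong[OF refl], rule arg_cong[where f = Not], (rule bex_cong[OF refl])+) auto

definition graph_on :: "nat \<Rightarrow> (nat \<Rightarrow> nat) \<Rightarrow> (nat \<times> nat) set" where
  "graph_on n \<sigma> = (\<lambda>i. (i, \<sigma> i)) ` {1..n}"

lemma cross_count_graph_on: "cross_count (graph_on n \<sigma>) = cr n \<sigma>"
proof -
  have "{(P, Q). P \<in> graph_on n \<sigma> \<and> Q \<in> graph_on n \<sigma> \<and> cross P Q} =
      (\<lambda>(i, j). ((i, \<sigma> i), (j, \<sigma> j))) ` crossings n \<sigma>"
    by (auto simp: graph_on_def crossings_def cross_def image_iff)
  then show ?thesis
    unfolding cross_count_def cr_def by (simp add: card_image inj_on_def split_def prod_eq_iff)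
qed

lemma bij_betw_graph_on:
  "bij_betw (graph_on n) (avoiders n [1, 3, 2]) {S. perm_matrix n 0 0 S \<and> avoids_132 S}"
  unfolding bij_betw_def
proof
  show "inj_on (graph_on n) (avoiders n [1, 3, 2])"
  proof (rule inj_onI)
    fix \<sigma> \<sigma>'
    assume \<sigma>: "\<sigma> \<in> avoiders n [1, 3, 2]" "\<sigma>' \<in> avoiders n [1, 3, 2]"
      and eq: "graph_on n \<sigma> = graph_on n \<sigma>'"
    show "\<sigma> = \<sigma>'"
    proof
      fix i
      show "\<sigma> i = \<sigma>' i"
      proof (cases "i \<in> {1..n}")
        case True
        then have "(i, \<sigma> i) \<in> graph_on n \<sigma>'" unfolding eq[symmetric] by (auto simp: graph_on_def)
        then show ?thesis by (auto simp: graph_on_def)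
      next
        case False
        then show ?thesis using \<sigma> unfolding avoiders_def by (metis (no_types, lifting) mem_Collect_eq permutes_not_in)
      qed
    qed
  qed
  show "graph_on n ` avoiders n [1, 3, 2] = {S. perm_matrix n 0 0 S \<and> avoids_132 S}"
  proof (intro equalityI subsetI)
    fix S assume "S \<in> graph_on n ` avoiders n [1, 3, 2]"
    then obtain \<sigma> where \<sigma>: "\<sigma> \<in> avoiders n [1, 3, 2]" "S = graph_on n \<sigma>" by auto
    then have perm: "\<sigma> permutes {1..n}" by (simp add: avoiders_def)
    have "bij_betw fst S {0<..0 + n}"
      unfolding \<sigma> graph_on_def bij_betw_def by (force simp: inj_on_def)
    moreover have "bij_betw snd S {0<..0 + n}"
      unfolding bij_betw_def
    proof
      show "inj_on snd S"
        unfolding \<sigma> graph_on_def using permutes_inj[OF perm] by (auto simp: inj_on_def)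
      have "snd ` S = \<sigma> ` {1..n}" unfolding \<sigma> graph_on_def by (simp add: image_image)
      then show "snd ` S = {0<..0 + n}" unfolding permutes_image[OF perm] by auto
    qed
    moreover have "avoids_132 S"
      using \<sigma> unfolding avoiders_132 avoids_132_def graph_on_def by simp
    ultimately show "S \<in> {S. perm_matrix n 0 0 S \<and> avoids_132 S}"
      by (simp add: perm_matrix_def)
  next
    fix S assume "S \<in> {S. perm_matrix n 0 0 S \<and> avoids_132 S}"
    then have S: "bij_betw fst S {1..n}" "bij_betw snd S {1..n}" "avoids_132 S"
      by (auto simp: perm_matrix_def atLeastSucAtMost_greaterThanAtMost)
    \<comment> \<open>The value is read off the unique point of \<open>S\<close> above
      \<open>i\<close>; the identity elsewhere is what \<open>permutes\<close> demands.\<close>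
    define \<sigma> where "\<sigma> i = (if i \<in> {1..n} then snd (inv_into S fst i) else i)" for i
    have inv: "bij_betw (inv_into S fst) {1..n} S"
      using S(1) by (rule bij_betw_inv_into)
    have \<sigma>S: "(i, \<sigma> i) \<in> S" if "i \<in> {1..n}" for i
    proof -
      have "inv_into S fst i \<in> S" using inv that by (auto simp: bij_betw_def)
      moreover have "fst (inv_into S fst i) = i"
        using S(1) that by (metis bij_betw_inv_into_right)
      ultimately show ?thesis using that by (simp add: \<sigma>_def) (metis prod.collapse)
    qed
    have "bij_betw (snd \<circ> inv_into S fst) {1..n} {1..n}"
      using bij_betw_trans[OF inv S(2)] .
    then have "bij_betw \<sigma> {1..n} {1..n}"
      by (rule bij_betw_cong[THEN iffD1, rotated]) (simp add: \<sigma>_def)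
    then have perm: "\<sigma> permutes {1..n}"
      by (rule bij_imp_permutes) (auto simp: \<sigma>_def)
    have graph: "graph_on n \<sigma> = S"
    proof
      show "graph_on n \<sigma> \<subseteq> S" using \<sigma>S by (auto simp: graph_on_def)
      show "S \<subseteq> graph_on n \<sigma>"
      proof
        fix P assume P: "P \<in> S"
        then have "fst P \<in> {1..n}" using S(1) by (auto simp: bij_betw_def)
        moreover have "P = (fst P, \<sigma> (fst P))"
          using inj_onD[OF bij_betw_imp_inj_on[OF S(1)] _ P \<sigma>S[OF calculation]] by simp
        ultimately show "P \<in> graph_on n \<sigma>" unfolding graph_on_def by blast
      qed
    qed
    have "\<sigma> \<in> avoiders n [1, 3, 2]"
      unfolding avoiders_132
    proof (intro conjI perm notI)
      assume "\<exists>i\<in>{1..n}. \<exists>j\<in>{1..n}. \<exists>k\<in>{1..n}. i < j \<and> j < k \<and> \<sigma> i < \<sigma> k \<and> \<sigma> k < \<sigma> j"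
      then obtain i j k where "i \<in> {1..n}" "j \<in> {1..n}" "k \<in> {1..n}"
        "i < j" "j < k" "\<sigma> i < \<sigma> k" "\<sigma> k < \<sigma> j" by blast
      then show False
        using S(3) \<sigma>S[of i] \<sigma>S[of j] \<sigma>S[of k] unfolding avoids_132_def
        by (metis fst_conv snd_conv)
    qed
    then show "S \<in> graph_on n ` avoiders n [1, 3, 2]" using graph by blast
  qed
qed

text \<open>Twice either side plus \<open>nodes t\<close> is the sum of \<open>cut\<close> over all
  windows; zero offsets satisfy the invariant of \<open>sum_cut\<close>.\<close>

lemma cross_count_eq_weight:
  "cross_count (points t 0 0) = weight (word t)"
  using weight_word[of t "nodes t"] sum_cut[of 0 0 t "nodes t" 0] by simp

lemma sum_avoiders_132:
  "(\<Sum>\<sigma>\<in>avoiders n [1, 3, 2]. monom 1 (cr n \<sigma>)) = transfer n 0"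
proof -
  have "(\<Sum>\<sigma>\<in>avoiders n [1, 3, 2]. monom 1 (cr n \<sigma>)) =
      (\<Sum>\<sigma>\<in>avoiders n [1, 3, 2]. monom (1::int) (cross_count (graph_on n \<sigma>)))"
    by (simp add: cross_count_graph_on)
  also have "\<dots> = (\<Sum>S\<in>{S. perm_matrix n 0 0 S \<and> avoids_132 S}. monom 1 (cross_count S))"
    by (rule sum.reindex_bij_betw[OF bij_betw_graph_on])
  also have "\<dots> = (\<Sum>t\<in>{t. nodes t = n}. monom 1 (cross_count (points t 0 0)))"
    by (rule sum.reindex_bij_betw[OF bij_betw_points, symmetric])
  also have "\<dots> = (\<Sum>t\<in>{t. nodes t = n}. monom 1 (weight (word t)))"
    by (simp add: cross_count_eq_weight)
  also have "\<dots> = (\<Sum>w\<in>words (2 * n) 0 0. monom 1 (weight w))"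
    by (rule sum.reindex_bij_betw[OF bij_betw_word])
  also have "\<dots> = transfer n 0"
    by (rule sum_words_weight) simp
  finally show ?thesis .
qed

subsection \<open>Inverse-reverse-complement\<close>

definition flip :: "nat \<Rightarrow> nat \<Rightarrow> nat" where
  "flip n i = (if i \<in> {1..n} then n + 1 - i else i)"

text \<open>Reflects the graph in the antidiagonal: the point \<open>(i, \<sigma> i)\<close> becomes
  \<open>(n + 1 - \<sigma> i, n + 1 - i)\<close>.\<close>

definition flip_inv :: "nat \<Rightarrow> (nat \<Rightarrow> nat) \<Rightarrow> nat \<Rightarrow> nat" where
  "flip_inv n \<sigma> = flip n \<circ> inv \<sigma> \<circ> flip n"

lemma flip_flip [simp]: "flip n (flip n i) = i"
  by (auto simp: flip_def)

lemma flip_permutes: "flip n permutes {1..n}"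
  by (rule bij_imp_permutes, rule bij_betw_byWitness[where f' = "flip n"]) (auto simp: flip_def)

lemma flip_less: "i \<in> {1..n} \<Longrightarrow> j \<in> {1..n} \<Longrightarrow> flip n i < flip n j \<longleftrightarrow> j < i"
  by (auto simp: flip_def)

lemma flip_inv_permutes: "\<sigma> permutes {1..n} \<Longrightarrow> flip_inv n \<sigma> permutes {1..n}"
  unfolding flip_inv_def by (intro permutes_compose flip_permutes permutes_inv)

lemma flip_inv_flip: "\<sigma> permutes {1..n} \<Longrightarrow> flip_inv n \<sigma> (flip n (\<sigma> i)) = flip n i"
  by (simp add: flip_inv_def permutes_inverses)

lemma flip_inv_flip_inv:
  assumes "\<sigma> permutes {1..n}"
  shows "flip_inv n (flip_inv n \<sigma>) = \<sigma>"
proof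
  fix i
  have "flip_inv n (flip_inv n \<sigma>) (flip n (flip_inv n \<sigma> (flip n (\<sigma> i)))) = flip n (flip n (\<sigma> i))"
    by (rule flip_inv_flip[OF flip_inv_permutes[OF assms]])
  then show "flip_inv n (flip_inv n \<sigma>) i = \<sigma> i"
    by (simp add: flip_inv_flip[OF assms])
qed

text \<open>The reflection reverses both points of a crossing and keeps upper crossings upper and
  lower ones lower. Equality will follow because it is an involution.\<close>

lemma cr_flip_inv_le:
  assumes "\<sigma> permutes {1..n}"
  shows "cr n \<sigma> \<le> cr n (flip_inv n \<sigma>)"
  unfolding cr_def
proof (rule card_inj_on_le)
  have mem: "\<sigma> i \<in> {1..n} \<longleftrightarrow> i \<in> {1..n}" for i
    using permutes_in_image[OF assms] .
  show "inj_on (\<lambda>(i, j). (flip n (\<sigma> j), flip n (\<sigma> i))) (crossings n \<sigma>)"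
    by (rule inj_onI) (auto simp: inj_eq[OF permutes_inj[OF flip_permutes]] inj_eq[OF permutes_inj[OF assms]])
  show "(\<lambda>(i, j). (flip n (\<sigma> j), flip n (\<sigma> i))) ` crossings n \<sigma> \<subseteq> crossings n (flip_inv n \<sigma>)"
  proof clarify
    fix i j assume ij: "(i, j) \<in> crossings n \<sigma>"
    then have "i \<in> {1..n}" "j \<in> {1..n}" by (auto simp: crossings_def)
    moreover from this have "\<sigma> i \<in> {1..n}" "\<sigma> j \<in> {1..n}" using mem by auto
    ultimately show "(flip n (\<sigma> j), flip n (\<sigma> i)) \<in> crossings n (flip_inv n \<sigma>)"
      using ij by (simp add: crossings_def flip_inv_flip[OF assms]) (auto simp: flip_def)
  qed
  show "finite (crossings n (flip_inv n \<sigma>))"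
    by (rule finite_subset[of _ "{1..n} \<times> {1..n}"]) (auto simp: crossings_def)
qed

lemma cr_flip_inv: "\<sigma> permutes {1..n} \<Longrightarrow> cr n (flip_inv n \<sigma>) = cr n \<sigma>"
  using cr_flip_inv_le[of \<sigma> n] cr_flip_inv_le[OF flip_inv_permutes, of \<sigma> n]
  by (simp add: flip_inv_flip_inv)

lemma flip_inv_avoids_213:
  assumes "\<sigma> \<in> avoiders n [1, 3, 2]"
  shows "flip_inv n \<sigma> \<in> avoiders n [2, 1, 3]"
proof -
  have perm: "\<sigma> permutes {1..n}" using assms by (simp add: avoiders_def)
  define \<rho> where "\<rho> = flip_inv n \<sigma>"
  have perm': "\<rho> permutes {1..n}" unfolding \<rho>_def by (rule flip_inv_permutes[OF perm])
  have \<sigma>\<rho>: "\<sigma> (flip n (\<rho> i)) = flip n i" for i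
    using flip_inv_flip[OF perm', of i] flip_inv_flip_inv[OF perm] by (simp add: \<rho>_def)
  have mem: "flip n (\<rho> i) \<in> {1..n}" if "i \<in> {1..n}" for i
    using that permutes_in_image[OF perm'] permutes_in_image[OF flip_permutes] by blast
  have mem': "\<rho> i \<in> {1..n}" if "i \<in> {1..n}" for i
    using that permutes_in_image[OF perm'] by blast
  show ?thesis
    unfolding avoiders_213 \<rho>_def[symmetric]
  proof (intro conjI notI perm')
    assume "\<exists>i\<in>{1..n}. \<exists>j\<in>{1..n}. \<exists>k\<in>{1..n}. i < j \<and> j < k \<and> \<rho> j < \<rho> i \<and> \<rho> i < \<rho> k"
    then obtain i j k where o: "i \<in> {1..n}" "j \<in> {1..n}" "k \<in> {1..n}" "i < j" "j < k"
      "\<rho> j < \<rho> i" "\<rho> i < \<rho> k" by blast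
    \<comment> \<open>The reflected points come in the order \<open>k\<close>, \<open>i\<close>,
      \<open>j\<close>, and their values form a 132 in \<open>\<sigma>\<close>.\<close>
    have "flip n (\<rho> k) < flip n (\<rho> i)" "flip n (\<rho> i) < flip n (\<rho> j)"
      "\<sigma> (flip n (\<rho> k)) < \<sigma> (flip n (\<rho> j))" "\<sigma> (flip n (\<rho> j)) < \<sigma> (flip n (\<rho> i))"
      using o by (simp_all only: \<sigma>\<rho> flip_less mem')
    then show False using assms mem o unfolding avoiders_132 by blast
  qed
qed

lemma flip_inv_avoids_132:
  assumes "\<sigma> \<in> avoiders n [2, 1, 3]"
  shows "flip_inv n \<sigma> \<in> avoiders n [1, 3, 2]"
proof -
  have perm: "\<sigma> permutes {1..n}" using assms by (simp add: avoiders_def)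
  define \<rho> where "\<rho> = flip_inv n \<sigma>"
  have perm': "\<rho> permutes {1..n}" unfolding \<rho>_def by (rule flip_inv_permutes[OF perm])
  have \<sigma>\<rho>: "\<sigma> (flip n (\<rho> i)) = flip n i" for i
    using flip_inv_flip[OF perm', of i] flip_inv_flip_inv[OF perm] by (simp add: \<rho>_def)
  have mem: "flip n (\<rho> i) \<in> {1..n}" if "i \<in> {1..n}" for i
    using that permutes_in_image[OF perm'] permutes_in_image[OF flip_permutes] by blast
  have mem': "\<rho> i \<in> {1..n}" if "i \<in> {1..n}" for i
    using that permutes_in_image[OF perm'] by blast
  show ?thesis
    unfolding avoiders_132 \<rho>_def[symmetric]
  proof (intro conjI notI perm')
    assume "\<exists>i\<in>{1..n}. \<exists>j\<in>{1..n}. \<exists>k\<in>{1..n}. i < j \<and> j < k \<and> \<rho> i < \<rho> k \<and> \<rho> k < \<rho> j"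
    then obtain i j k where o: "i \<in> {1..n}" "j \<in> {1..n}" "k \<in> {1..n}" "i < j" "j < k"
      "\<rho> i < \<rho> k" "\<rho> k < \<rho> j" by blast
    \<comment> \<open>Now the order is \<open>j\<close>, \<open>k\<close>, \<open>i\<close>, and the
      values form a 213.\<close>
    have "flip n (\<rho> j) < flip n (\<rho> k)" "flip n (\<rho> k) < flip n (\<rho> i)"
      "\<sigma> (flip n (\<rho> k)) < \<sigma> (flip n (\<rho> j))" "\<sigma> (flip n (\<rho> j)) < \<sigma> (flip n (\<rho> i))"
      using o by (simp_all only: \<sigma>\<rho> flip_less mem')
    then show False using assms mem o unfolding avoiders_213 by blast
  qed
qed

lemma sum_avoiders_213:
  "(\<Sum>\<sigma>\<in>avoiders n [2, 1, 3]. monom (1::int) (cr n \<sigma>)) =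
     (\<Sum>\<sigma>\<in>avoiders n [1, 3, 2]. monom 1 (cr n \<sigma>))"
proof (rule sum.reindex_bij_witness[where i = "flip_inv n" and j = "flip_inv n"])
  fix \<sigma> assume "\<sigma> \<in> avoiders n [2, 1, 3]"
  moreover from this have "\<sigma> permutes {1..n}" unfolding avoiders_def by simp
  ultimately show "flip_inv n (flip_inv n \<sigma>) = \<sigma>" "flip_inv n \<sigma> \<in> avoiders n [1, 3, 2]"
    "monom 1 (cr n (flip_inv n \<sigma>)) = monom (1::int) (cr n \<sigma>)"
    by (simp_all only: flip_inv_flip_inv flip_inv_avoids_132 cr_flip_inv)
next
  fix \<sigma> assume "\<sigma> \<in> avoiders n [1, 3, 2]"
  moreover from this have "\<sigma> permutes {1..n}" unfolding avoiders_def by simp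
  ultimately show "flip_inv n (flip_inv n \<sigma>) = \<sigma>" "flip_inv n \<sigma> \<in> avoiders n [2, 1, 3]"
    by (simp_all only: flip_inv_flip_inv flip_inv_avoids_213)
qed

subsection \<open>Pairs of sets under a ballot condition\<close>

text \<open>Paths of length \<open>2 * n\<close> from height 0 to \<open>2 * a\<close>: for each
  \<open>k\<close> a step down iff \<open>k \<in> F\<close>, then a step up iff
  \<open>k \<in> E\<close>. Between the two steps the height is \<open>2 * g + 1\<close>, where
  \<open>g\<close> is the gap between the two counts, so the ballot condition keeps the path
  nonnegative.\<close>

definition ballot_pairs :: "nat \<Rightarrow> nat \<Rightarrow> (nat set \<times> nat set) set" where
  "ballot_pairs n a = {(E, F). E \<subseteq> {1..n} \<and> F \<subseteq> {1..n} \<and> card E = card F + a \<and>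
     (\<forall>k\<in>{1..n}. card {v \<in> F. v \<le> k} \<le> card {i \<in> E. i < k})}"

definition gap_sum :: "nat \<Rightarrow> nat set \<times> nat set \<Rightarrow> nat" where
  "gap_sum n = (\<lambda>(E, F). \<Sum>k=1..n. card {i \<in> E. i < k} - card {v \<in> F. v \<le> k})"

lemma finite_ballot_pairs [simp]: "finite (ballot_pairs n a)"
  by (rule finite_subset[of _ "Pow {1..n} \<times> Pow {1..n}"]) (auto simp: ballot_pairs_def)

definition extend :: "nat \<Rightarrow> bool \<Rightarrow> bool \<Rightarrow> nat set \<times> nat set \<Rightarrow> nat set \<times> nat set" where
  "extend N e f = (\<lambda>(E, F). (if e then insert N E else E, if f then insert N F else F))"

lemma extend_cards:
  assumes "E \<subseteq> {1..n}" "F \<subseteq> {1..n}" "(E', F') = extend (Suc n) e f (E, F)"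
  shows "card E' = card E + of_bool e" "card F' = card F + of_bool f"
    "k \<le> n \<Longrightarrow> {i \<in> E'. i < k} = {i \<in> E. i < k}"
    "k \<le> n \<Longrightarrow> {v \<in> F'. v \<le> k} = {v \<in> F. v \<le> k}"
    "card {i \<in> E'. i < Suc n} = card E" "card {v \<in> F'. v \<le> Suc n} = card F + of_bool f"
proof -
  have fin: "finite E" "finite F" using assms finite_subset by auto
  have N: "Suc n \<notin> E" "Suc n \<notin> F" using assms by auto
  show c: "card E' = card E + of_bool e" "card F' = card F + of_bool f"
    using fin N assms(3) by (auto simp: extend_def)
  show "k \<le> n \<Longrightarrow> {i \<in> E'. i < k} = {i \<in> E. i < k}" "k \<le> n \<Longrightarrow> {v \<in> F'. v \<le> k} = {v \<in> F. v \<le> k}"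
    using assms(3) by (auto simp: extend_def split: if_splits)
  have "{i \<in> E'. i < Suc n} = E" "{v \<in> F'. v \<le> Suc n} = F'"
    using assms by (auto simp: extend_def split: if_splits)
  then show "card {i \<in> E'. i < Suc n} = card E" "card {v \<in> F'. v \<le> Suc n} = card F + of_bool f"
    using c by simp_all
qed

text \<open>At \<open>Suc n\<close> the ballot condition compares the new \<open>F\<close> with the
  old \<open>E\<close>; given the prescribed difference \<open>a\<close>, it says
  \<open>of_bool e \<le> a\<close>.\<close>

lemma extend_ballot_iff:
  assumes "E \<subseteq> {1..n}" "F \<subseteq> {1..n}"
  shows "extend (Suc n) e f (E, F) \<in> ballot_pairs (Suc n) a \<longleftrightarrow>
    card E + of_bool e = card F + of_bool f + a \<and> of_bool e \<le> a \<and>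
    (\<forall>k\<in>{1..n}. card {v \<in> F. v \<le> k} \<le> card {i \<in> E. i < k})"
proof -
  obtain E' F' where EF: "(E', F') = extend (Suc n) e f (E, F)" by (metis surj_pair)
  note c = extend_cards[OF assms EF]
  have "E' \<subseteq> {1..Suc n}" "F' \<subseteq> {1..Suc n}"
    using assms EF by (auto simp: extend_def split: if_splits)
  then have "(E', F') \<in> ballot_pairs (Suc n) a \<longleftrightarrow>
      card E' = card F' + a \<and> card {v \<in> F'. v \<le> Suc n} \<le> card {i \<in> E'. i < Suc n} \<and>
      (\<forall>k\<in>{1..n}. card {v \<in> F'. v \<le> k} \<le> card {i \<in> E'. i < k})"
    by (auto simp: ballot_pairs_def atLeastAtMostSuc_conv)
  also have "(\<forall>k\<in>{1..n}. card {v \<in> F'. v \<le> k} \<le> card {i \<in> E'. i < k}) \<longleftrightarrow>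
      (\<forall>k\<in>{1..n}. card {v \<in> F. v \<le> k} \<le> card {i \<in> E. i < k})"
    using c(3,4) by simp
  finally show ?thesis unfolding EF c by auto
qed

lemma extend_ballot:
  assumes "(E, F) \<in> ballot_pairs n b" "b + of_bool e = a + of_bool f" "of_bool e \<le> a"
  shows "extend (Suc n) e f (E, F) \<in> ballot_pairs (Suc n) a"
    and "gap_sum (Suc n) (extend (Suc n) e f (E, F)) = gap_sum n (E, F) + (a - of_bool e)"
proof -
  have EF: "E \<subseteq> {1..n}" "F \<subseteq> {1..n}" "card E = card F + b"
    using assms by (auto simp: ballot_pairs_def)
  show "extend (Suc n) e f (E, F) \<in> ballot_pairs (Suc n) a"
    using assms EF by (subst extend_ballot_iff) (auto simp: ballot_pairs_def)
  obtain E' F' where EF': "(E', F') = extend (Suc n) e f (E, F)" by (metis surj_pair)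
  note c = extend_cards[OF EF(1,2) EF']
  have "(\<Sum>k=1..n. card {i \<in> E'. i < k} - card {v \<in> F'. v \<le> k}) =
      (\<Sum>k=1..n. card {i \<in> E. i < k} - card {v \<in> F. v \<le> k})"
    by (rule sum.cong) (simp_all add: c(3,4))
  moreover have "card {i \<in> E'. i < Suc n} - card {v \<in> F'. v \<le> Suc n} = a - of_bool e"
    unfolding c using assms EF(3) by simp
  ultimately show "gap_sum (Suc n) (extend (Suc n) e f (E, F)) = gap_sum n (E, F) + (a - of_bool e)"
    unfolding EF'[symmetric] by (simp add: gap_sum_def)
qed

text \<open>The last two steps allow four choices; before them the difference of cardinalities was
  \<open>a + of_bool f - of_bool e\<close>, and \<open>e\<close> requires
  \<open>a > 0\<close>.\<close>

lemma ballot_pairs_Suc: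
  "ballot_pairs (Suc n) a =
     (extend (Suc n) False False ` ballot_pairs n a \<union>
      extend (Suc n) False True ` ballot_pairs n (Suc a)) \<union>
     (if a = 0 then {} else extend (Suc n) True False ` ballot_pairs n (a - 1) \<union>
      extend (Suc n) True True ` ballot_pairs n a)" (is "?L = ?R")
proof
  show "?R \<subseteq> ?L"
    using extend_ballot(1)[of _ _ n a False a False] extend_ballot(1)[of _ _ n "Suc a" False a True]
      extend_ballot(1)[of _ _ n "a - 1" True a False] extend_ballot(1)[of _ _ n a True a True]
    by (auto simp: image_subset_iff)
  show "?L \<subseteq> ?R"
  proof
    fix p assume "p \<in> ?L"
    then obtain E' F' where p: "p = (E', F')" and m: "(E', F') \<in> ballot_pairs (Suc n) a"
      by (cases p) auto
    define E F e f where "E = E' - {Suc n}" and "F = F' - {Suc n}"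
      and "e \<longleftrightarrow> Suc n \<in> E'" and "f \<longleftrightarrow> Suc n \<in> F'"
    have ext: "(E', F') = extend (Suc n) e f (E, F)"
      by (auto simp: E_def F_def e_def f_def extend_def)
    have sub: "E \<subseteq> {1..n}" "F \<subseteq> {1..n}"
      using m by (auto simp: E_def F_def ballot_pairs_def le_Suc_eq)
    have *: "card E + of_bool e = card F + of_bool f + a" "of_bool e \<le> a"
      "\<forall>k\<in>{1..n}. card {v \<in> F. v \<le> k} \<le> card {i \<in> E. i < k}"
      using m[unfolded ext extend_ballot_iff[OF sub]] by blast+
    then have mem: "(E, F) \<in> ballot_pairs n (a + of_bool f - of_bool e)"
      using sub by (auto simp: ballot_pairs_def)
    show "p \<in> ?R"
      unfolding p ext using mem *(2) by (cases e; cases f) auto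
  qed
qed

lemma inj_on_extend: "inj_on (extend (Suc n) e f) (ballot_pairs n b)"
proof (rule inj_onI, clarify)
  fix E F E' F'
  assume m: "(E, F) \<in> ballot_pairs n b" "(E', F') \<in> ballot_pairs n b"
    and eq: "extend (Suc n) e f (E, F) = extend (Suc n) e f (E', F')"
  have "Suc n \<notin> E" "Suc n \<notin> F" "Suc n \<notin> E'" "Suc n \<notin> F'"
    using m by (auto simp: ballot_pairs_def)
  then show "E = E' \<and> F = F'"
    using eq by (auto simp: extend_def insert_ident split: if_splits)
qed

lemma sum_extend:
  assumes "b + of_bool e = a + of_bool f" "of_bool e \<le> a"
  shows "(\<Sum>p\<in>extend (Suc n) e f ` ballot_pairs n b. monom (1::int) (gap_sum (Suc n) p)) =
    monom 1 (a - of_bool e) * (\<Sum>p\<in>ballot_pairs n b. monom 1 (gap_sum n p))"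
proof -
  have "gap_sum (Suc n) (extend (Suc n) e f p) = gap_sum n p + (a - of_bool e)"
    if "p \<in> ballot_pairs n b" for p
    using extend_ballot(2)[of "fst p" "snd p" n b e a f] that assms by simp
  then show ?thesis
    by (simp add: sum.reindex[OF inj_on_extend] sum_distrib_left mult_monom add.commute)
qed

lemma extend_disjoint:
  assumes "(e, f) \<noteq> (e', f')"
  shows "extend (Suc n) e f ` ballot_pairs n b \<inter> extend (Suc n) e' f' ` ballot_pairs n b' = {}"
proof -
  have "Suc n \<notin> E \<and> Suc n \<notin> F" if "(E, F) \<in> ballot_pairs n b" for E F b
    using that by (auto simp: ballot_pairs_def)
  then have "(Suc n \<in> fst p \<longleftrightarrow> e) \<and> (Suc n \<in> snd p \<longleftrightarrow> f)"
    if "p \<in> extend (Suc n) e f ` ballot_pairs n b" for p e f b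
    using that by (force simp: extend_def)
  then show ?thesis using assms by blast
qed

text \<open>Here \<open>transfer\<close> follows the path backwards from its end: the four pieces
  are its four products, and \<open>a - of_bool e\<close> is the gap at the last odd time.\<close>

lemma sum_ballot_pairs:
  "(\<Sum>p\<in>ballot_pairs n a. monom 1 (gap_sum n p)) = transfer n a"
proof (induction n arbitrary: a)
  case 0
  have "ballot_pairs 0 a = (if a = 0 then {({}, {})} else {})"
    by (auto simp: ballot_pairs_def)
  then show ?case by (simp add: gap_sum_def monom_0)
next
  case (Suc n)
  let ?s = "\<lambda>X. \<Sum>p\<in>X. monom (1::int) (gap_sum (Suc n) p)"
  have FF: "?s (extend (Suc n) False False ` ballot_pairs n a) = monom 1 a * transfer n a"
    using sum_extend[of a False a False n] by (simp add: Suc.IH)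
  have FT: "?s (extend (Suc n) False True ` ballot_pairs n (Suc a)) =
      monom 1 a * transfer n (Suc a)"
    using sum_extend[of "Suc a" False a True n] by (simp add: Suc.IH)
  show ?case
  proof (cases a)
    case 0
    then show ?thesis
      unfolding ballot_pairs_Suc using FF FT
      by (simp add: sum.union_disjoint extend_disjoint distrib_left)
  next
    case a: (Suc b)
    have TF: "?s (extend (Suc n) True False ` ballot_pairs n b) = monom 1 b * transfer n b"
      using sum_extend[of b True a False n] a by (simp add: Suc.IH)
    have TT: "?s (extend (Suc n) True True ` ballot_pairs n a) = monom 1 b * transfer n a"
      using sum_extend[of a True a True n] a by (simp add: Suc.IH)
    have "?s (ballot_pairs (Suc n) a) =
        ?s (extend (Suc n) False False ` ballot_pairs n a \<union>
          extend (Suc n) False True ` ballot_pairs n (Suc a)) +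
        ?s (extend (Suc n) True False ` ballot_pairs n b \<union>
          extend (Suc n) True True ` ballot_pairs n a)"
      unfolding ballot_pairs_Suc using a
      by (simp, subst sum.union_disjoint) (auto simp: Int_Un_distrib Int_Un_distrib2 extend_disjoint)
    also have "\<dots> = (monom 1 a * transfer n a + monom 1 a * transfer n (Suc a)) +
        (monom 1 b * transfer n b + monom 1 b * transfer n a)"
      by (simp add: sum.union_disjoint extend_disjoint FF FT TF TT)
    finally show ?thesis using a by (simp add: distrib_left)
  qed
qed

subsection \<open>321-avoiding permutations\<close>

lemma card_less_strict_mono_on:
  fixes f :: "nat \<Rightarrow> nat"
  assumes "strict_mono_on A f" "x \<in> A"
  shows "card {y \<in> f ` A. y < f x} = card {z \<in> A. z < x}"
    and "card {y \<in> f ` A. y \<le> f x} = card {z \<in> A. z \<le> x}"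
proof -
  have inj: "inj_on f A" using assms(1) by (rule strict_mono_on_imp_inj_on)
  have "{y \<in> f ` A. y < f x} = f ` {z \<in> A. z < x}"
    using assms by (auto simp: strict_mono_on_less)
  then show "card {y \<in> f ` A. y < f x} = card {z \<in> A. z < x}"
    using inj by (simp add: card_image inj_on_def)
  have "{y \<in> f ` A. y \<le> f x} = f ` {z \<in> A. z \<le> x}"
    using assms by (auto simp: strict_mono_on_less_eq)
  then show "card {y \<in> f ` A. y \<le> f x} = card {z \<in> A. z \<le> x}"
    using inj by (simp add: card_image inj_on_def)
qed

lemma card_less_mono:
  fixes x y :: nat
  assumes "finite A" "x \<in> A" "x < y"
  shows "card {z \<in> A. z < x} < card {z \<in> A. z < y}"
  by (rule psubset_card_mono) (use assms in auto)

text \<open>Both values have in the common image the rank that \<open>x\<close> has in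
  \<open>A\<close>, and rank determines the element.\<close>

lemma strict_mono_on_unique:
  fixes f g :: "nat \<Rightarrow> nat"
  assumes "finite A" "strict_mono_on A f" "strict_mono_on A g" "f ` A = g ` A" "x \<in> A"
  shows "f x = g x"
proof -
  have "card {y \<in> f ` A. y < f x} = card {y \<in> f ` A. y < g x}"
    using card_less_strict_mono_on(1)[OF assms(2,5)] card_less_strict_mono_on(1)[OF assms(3,5)]
      assms(4) by simp
  moreover have "f x \<in> f ` A" "g x \<in> f ` A" "finite (f ` A)" using assms by auto
  ultimately show ?thesis
    using card_less_mono[of "f ` A" "f x" "g x"] card_less_mono[of "f ` A" "g x" "f x"]
    by (cases "f x" "g x" rule: linorder_cases) simp_all
qed

lemma ex_strict_mono_on:
  fixes A B :: "nat set"
  assumes "finite A" "finite B" "card A = card B"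
  obtains f where "strict_mono_on A f" "f ` A = B"
proof
  \<comment> \<open>\<open>x\<close> goes to the element of \<open>B\<close> of equal rank; rank and
    \<open>enumerate\<close> both count from 0.\<close>
  define f where "f x = enumerate B (card {z \<in> A. z < x})" for x
  have rank: "card {z \<in> A. z < x} < card B" if "x \<in> A" for x
    unfolding assms(3)[symmetric] by (rule psubset_card_mono) (use assms that in auto)
  show mono: "strict_mono_on A f"
    by (rule strict_mono_onI)
      (auto simp: f_def intro!: finite_enumerate_mono card_less_mono rank assms)
  show "f ` A = B"
  proof (rule card_subset_eq[OF assms(2)])
    show "f ` A \<subseteq> B"
      by (auto simp: f_def intro!: finite_enumerate_in_set rank assms)
    show "card (f ` A) = card B"
      using card_image[OF strict_mono_on_imp_inj_on[OF mono]] assms(3) by simp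
  qed
qed

definition excedances :: "nat \<Rightarrow> (nat \<Rightarrow> nat) \<Rightarrow> nat set" where
  "excedances n \<sigma> = {i \<in> {1..n}. i < \<sigma> i}"

text \<open>If \<open>\<sigma> j < \<sigma> i\<close>, avoidance makes all entries right of
  \<open>j\<close> exceed \<open>\<sigma> j\<close>. Then \<open>{j..n}\<close> maps injectively
  into the smaller set \<open>{\<sigma> j..n}\<close>.\<close>

lemma less_of_excedance:
  assumes "\<sigma> \<in> avoiders n [3, 2, 1]" "i \<in> {1..n}" "j \<in> {1..n}" "i < j" "j < \<sigma> j"
  shows "\<sigma> i < \<sigma> j"
proof (rule ccontr)
  have perm: "\<sigma> permutes {1..n}" using assms(1) by (simp add: avoiders_def)
  assume "\<not> \<sigma> i < \<sigma> j"
  then have gt: "\<sigma> j < \<sigma> i"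
    using inj_eq[OF permutes_inj[OF perm], of i j] assms(4) by linarith
  have "\<sigma> j < \<sigma> k" if "k \<in> {1..n}" "j < k" for k
  proof (rule ccontr)
    assume "\<not> \<sigma> j < \<sigma> k"
    then have "\<sigma> k < \<sigma> j"
      using inj_eq[OF permutes_inj[OF perm], of j k] that by linarith
    then show False using assms gt that unfolding avoiders_321 by blast
  qed
  then have "\<sigma> ` {j..n} \<subseteq> {\<sigma> j..n}"
    using permutes_in_image[OF perm] assms(3) by (fastforce simp: le_less)
  then have "card (\<sigma> ` {j..n}) \<le> card {\<sigma> j..n}" by (intro card_mono) auto
  moreover have "card (\<sigma> ` {j..n}) = card {j..n}"
    by (rule card_image[OF inj_on_subset[OF permutes_inj[OF perm]]]) simp
  moreover have "\<sigma> j \<le> n" using permutes_in_image[OF perm, of j] assms(3) by simp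
  ultimately show False using assms(3,5) by simp
qed

text \<open>If \<open>\<sigma> j < \<sigma> i\<close>, avoidance makes all entries left of
  \<open>i\<close> smaller than \<open>\<sigma> i\<close>. Then the \<open>i + 1\<close> positions
  \<open>insert j {1..i}\<close> map injectively into \<open>{1..i}\<close>.\<close>

lemma less_of_non_excedance:
  assumes "\<sigma> \<in> avoiders n [3, 2, 1]" "i \<in> {1..n}" "j \<in> {1..n}" "i < j" "\<sigma> i \<le> i"
  shows "\<sigma> i < \<sigma> j"
proof (rule ccontr)
  have perm: "\<sigma> permutes {1..n}" using assms(1) by (simp add: avoiders_def)
  assume "\<not> \<sigma> i < \<sigma> j"
  then have gt: "\<sigma> j < \<sigma> i"
    using inj_eq[OF permutes_inj[OF perm], of i j] assms(4) by linarith
  have left: "\<sigma> k < \<sigma> i" if "k \<in> {1..n}" "k < i" for k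
  proof (rule ccontr)
    assume "\<not> \<sigma> k < \<sigma> i"
    then have "\<sigma> i < \<sigma> k"
      using inj_eq[OF permutes_inj[OF perm], of i k] that by linarith
    then show False using assms gt that unfolding avoiders_321 by blast
  qed
  have "\<sigma> ` insert j {1..i} \<subseteq> {1..i}"
  proof (rule image_subsetI)
    fix k assume k: "k \<in> insert j {1..i}"
    then have "\<sigma> k \<in> {1..n}" using permutes_in_image[OF perm, of k] assms(2,3) by auto
    moreover have "\<sigma> k \<le> \<sigma> i"
    proof (cases "k = j \<or> k = i")
      case False
      then have "k \<in> {1..n}" "k < i" using k assms(2) by auto
      then show ?thesis using left by (simp add: less_imp_le)
    qed (use gt in auto)
    ultimately show "\<sigma> k \<in> {1..i}" using assms(5) by simp
  qed
  then have "card (\<sigma> ` insert j {1..i}) \<le> card {1..i}" by (intro card_mono) auto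
  moreover have "card (\<sigma> ` insert j {1..i}) = card (insert j {1..i})"
    by (rule card_image[OF inj_on_subset[OF permutes_inj[OF perm]]]) simp
  ultimately show False using assms(4) by simp
qed

lemma strict_mono_on_excedances:
  assumes "\<sigma> \<in> avoiders n [3, 2, 1]"
  shows "strict_mono_on (excedances n \<sigma>) \<sigma>"
    and "strict_mono_on ({1..n} - excedances n \<sigma>) \<sigma>"
  by (rule strict_mono_onI; use less_of_excedance[OF assms] less_of_non_excedance[OF assms]
      in \<open>auto simp: excedances_def not_less\<close>)+

text \<open>An excedance with value at most \<open>k\<close> has position below \<open>k\<close>;
  the other excedances below \<open>k\<close> jump over \<open>k\<close>. This gives the ballot
  condition and interprets the gap.\<close>

lemma gap_eq_card:
  assumes "\<sigma> permutes {1..n}" "k \<in> {1..n}"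
  shows "card {i \<in> excedances n \<sigma>. i < k} =
    card {v \<in> \<sigma> ` excedances n \<sigma>. v \<le> k} + card {i \<in> {1..n}. i < k \<and> k < \<sigma> i}"
proof -
  have "{i \<in> excedances n \<sigma>. i < k} =
      {i \<in> excedances n \<sigma>. \<sigma> i \<le> k} \<union> {i \<in> {1..n}. i < k \<and> k < \<sigma> i}"
    by (auto simp: excedances_def)
  moreover have "{i \<in> excedances n \<sigma>. \<sigma> i \<le> k} \<inter> {i \<in> {1..n}. i < k \<and> k < \<sigma> i} = {}"
    by auto
  ultimately have "card {i \<in> excedances n \<sigma>. i < k} =
      card {i \<in> excedances n \<sigma>. \<sigma> i \<le> k} + card {i \<in> {1..n}. i < k \<and> k < \<sigma> i}"
    by (simp add: card_Un_disjoint excedances_def)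
  moreover have "{v \<in> \<sigma> ` excedances n \<sigma>. v \<le> k} = \<sigma> ` {i \<in> excedances n \<sigma>. \<sigma> i \<le> k}"
    by auto
  moreover have "card (\<sigma> ` X) = card X" for X
    by (rule card_image[OF inj_on_subset[OF permutes_inj[OF assms(1)]]]) simp
  ultimately show ?thesis by simp
qed

text \<open>Remove from \<open>k\<close> positions, and from \<open>k\<close> values, the entries
  with both coordinates at most \<open>k\<close>; equally many remain.\<close>

lemma card_straddling:
  fixes n k :: nat
  assumes "\<sigma> permutes {1..n}" "k \<le> n"
  shows "card {j \<in> {1..n}. k < j \<and> \<sigma> j \<le> k} = card {i \<in> {1..n}. i \<le> k \<and> k < \<sigma> i}"
proof -
  have inj: "card (\<sigma> ` X) = card X" for X
    by (rule card_image[OF inj_on_subset[OF permutes_inj[OF assms(1)]]]) simp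
  have range: "\<sigma> i \<in> {1..n} \<longleftrightarrow> i \<in> {1..n}" for i
    using permutes_in_image[OF assms(1)] .
  define U V W where "U = {i \<in> {1..n}. i \<le> k \<and> \<sigma> i \<le> k}"
    and "V = {j \<in> {1..n}. k < j \<and> \<sigma> j \<le> k}" and "W = {i \<in> {1..n}. i \<le> k \<and> k < \<sigma> i}"
  have fin: "finite U" "finite V" "finite W" by (simp_all add: U_def V_def W_def)
  have "{1..k} = \<sigma> ` (U \<union> V)"
  proof
    show "{1..k} \<subseteq> \<sigma> ` (U \<union> V)"
    proof
      fix v assume v: "v \<in> {1..k}"
      then have "v \<in> \<sigma> ` {1..n}" unfolding permutes_image[OF assms(1)] using assms(2) by simp
      then show "v \<in> \<sigma> ` (U \<union> V)" using v by (fastforce simp: U_def V_def)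
    qed
    show "\<sigma> ` (U \<union> V) \<subseteq> {1..k}" using range by (fastforce simp: U_def V_def)
  qed
  then have "k = card (U \<union> V)" using inj[of "U \<union> V"] by (metis card_atLeastAtMost diff_Suc_1)
  moreover have "{1..k} = U \<union> W" using assms(2) by (auto simp: U_def W_def)
  then have "k = card (U \<union> W)" by (metis card_atLeastAtMost diff_Suc_1)
  moreover have "U \<inter> V = {}" "U \<inter> W = {}" by (auto simp: U_def V_def W_def)
  ultimately have "card V = card W" using fin by (simp add: card_Un_disjoint)
  then show ?thesis by (simp add: V_def W_def)
qed

text \<open>
  Each upper crossing \<open>(i, j)\<close> is charged to \<open>j\<close>, which is an excedance, and each
  lower crossing to \<open>i\<close>, which is not; either way the number of crossings charged to
  \<open>k\<close> is the number of \<open>i < k\<close> with \<open>\<sigma> i > k\<close>.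
\<close>

lemma cr_avoiders_321:
  assumes "\<sigma> \<in> avoiders n [3, 2, 1]"
  shows "cr n \<sigma> = (\<Sum>k=1..n. card {i \<in> {1..n}. i < k \<and> k < \<sigma> i})"
proof -
  have perm: "\<sigma> permutes {1..n}" using assms by (simp add: avoiders_def)
  define C where "C k = (if k < \<sigma> k then (\<lambda>i. (i, k)) ` {i \<in> {1..n}. i < k \<and> k < \<sigma> i}
    else (\<lambda>j. (k, j)) ` {j \<in> {1..n}. k < j \<and> \<sigma> j \<le> k})" for k
  have "crossings n \<sigma> = (\<Union>k\<in>{1..n}. C k)"
  proof
    show "crossings n \<sigma> \<subseteq> (\<Union>k\<in>{1..n}. C k)"
    proof clarify
      fix i j assume ij: "(i, j) \<in> crossings n \<sigma>"
      then have r: "i \<in> {1..n}" "j \<in> {1..n}" by (auto simp: crossings_def)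
      from ij consider "i < j" "j < \<sigma> i" "\<sigma> i < \<sigma> j" | "i < j" "\<sigma> i < \<sigma> j" "\<sigma> j \<le> i"
        by (auto simp: crossings_def)
      then show "(i, j) \<in> (\<Union>k\<in>{1..n}. C k)"
      proof cases
        case 1
        then have "(i, j) \<in> C j" using r by (auto simp: C_def)
        then show ?thesis using r by blast
      next
        case 2
        then have "(i, j) \<in> C i" using r by (auto simp: C_def)
        then show ?thesis using r by blast
      qed
    qed
    \<comment> \<open>\<open>C k\<close> does not compare the two values; avoidance supplies that
      inequality, since \<open>k\<close> is the later index and an excedance, or the earlier one and
      not an excedance.\<close>
    show "(\<Union>k\<in>{1..n}. C k) \<subseteq> crossings n \<sigma>"
      using less_of_excedance[OF assms] less_of_non_excedance[OF assms]
      by (auto simp: C_def crossings_def split: if_splits)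
  qed
  moreover have "finite (C k)" for k by (auto simp: C_def)
  moreover have "C k \<inter> C l = {}" if "k \<noteq> l" for k l
    using that by (auto simp: C_def split: if_splits)
  ultimately have "cr n \<sigma> = (\<Sum>k=1..n. card (C k))"
    unfolding cr_def by (simp add: card_UN_disjoint)
  also have "\<dots> = (\<Sum>k=1..n. card {i \<in> {1..n}. i < k \<and> k < \<sigma> i})"
  proof (rule sum.cong)
    fix k assume k: "k \<in> {1..n}"
    show "card (C k) = card {i \<in> {1..n}. i < k \<and> k < \<sigma> i}"
    proof (cases "k < \<sigma> k")
      case True
      then show ?thesis by (simp add: C_def card_image inj_on_def)
    next
      case False
      \<comment> \<open>\<open>card_straddling\<close> admits \<open>i = k\<close>, which is
        excluded because \<open>\<sigma> k \<le> k\<close>.\<close>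
      then have "{i \<in> {1..n}. i \<le> k \<and> k < \<sigma> i} = {i \<in> {1..n}. i < k \<and> k < \<sigma> i}"
        by (auto simp: le_less)
      then show ?thesis
        using False card_straddling[OF perm, of k] k by (simp add: C_def card_image inj_on_def)
    qed
  qed simp
  finally show ?thesis .
qed

definition exc_pair :: "nat \<Rightarrow> (nat \<Rightarrow> nat) \<Rightarrow> nat set \<times> nat set" where
  "exc_pair n \<sigma> = (excedances n \<sigma>, \<sigma> ` excedances n \<sigma>)"

lemma gap_sum_exc_pair:
  assumes "\<sigma> \<in> avoiders n [3, 2, 1]"
  shows "gap_sum n (exc_pair n \<sigma>) = cr n \<sigma>"
proof -
  have "\<sigma> permutes {1..n}" using assms by (simp add: avoiders_def)
  then show ?thesis
    unfolding cr_avoiders_321[OF assms] gap_sum_def exc_pair_def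
    by (auto simp: gap_eq_card intro!: sum.cong)
qed

lemma exc_pair_in_ballot_pairs:
  assumes "\<sigma> permutes {1..n}"
  shows "exc_pair n \<sigma> \<in> ballot_pairs n 0"
proof -
  have "card (\<sigma> ` excedances n \<sigma>) = card (excedances n \<sigma>)"
    by (rule card_image[OF inj_on_subset[OF permutes_inj[OF assms]]]) simp
  moreover have "\<sigma> ` excedances n \<sigma> \<subseteq> {1..n}"
    using permutes_in_image[OF assms] by (fastforce simp: excedances_def)
  moreover have "excedances n \<sigma> \<subseteq> {1..n}" by (auto simp: excedances_def)
  ultimately show ?thesis
    by (simp add: exc_pair_def ballot_pairs_def gap_eq_card[OF assms])
qed

lemma inj_on_exc_pair: "inj_on (exc_pair n) (avoiders n [3, 2, 1])"
proof (rule inj_onI)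
  fix \<sigma> \<tau>
  assume s: "\<sigma> \<in> avoiders n [3, 2, 1]" and t: "\<tau> \<in> avoiders n [3, 2, 1]"
    and eq: "exc_pair n \<sigma> = exc_pair n \<tau>"
  have perm: "\<sigma> permutes {1..n}" "\<tau> permutes {1..n}" using s t by (simp_all add: avoiders_def)
  define E where "E = excedances n \<sigma>"
  have E: "E = excedances n \<tau>" "\<sigma> ` E = \<tau> ` E" "E \<subseteq> {1..n}"
    using eq by (auto simp: exc_pair_def E_def excedances_def)
  have "\<sigma> ` ({1..n} - E) = \<tau> ` ({1..n} - E)"
    using E(2) by (simp only: image_set_diff permutes_inj[OF perm(1)] permutes_inj[OF perm(2)]
        permutes_image[OF perm(1)] permutes_image[OF perm(2)])
  moreover have "finite E" using E(3) finite_subset by blast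
  ultimately have "\<sigma> i = \<tau> i" if "i \<in> {1..n}" for i
    using strict_mono_on_unique[of E \<sigma> \<tau> i] strict_mono_on_unique[of "{1..n} - E" \<sigma> \<tau> i]
      strict_mono_on_excedances[OF s, folded E_def] strict_mono_on_excedances[OF t, folded E(1)]
      E(2) that by (cases "i \<in> E") auto
  then show "\<sigma> = \<tau>" using perm by (metis ext permutes_not_in)
qed

text \<open>Map \<open>E\<close> increasingly onto \<open>F\<close> and the complement increasingly
  onto the complement; the ballot condition makes \<open>E\<close> the excedance set.\<close>

lemma exc_pair_surj:
  assumes "(E, F) \<in> ballot_pairs n 0"
  obtains \<sigma> where "\<sigma> \<in> avoiders n [3, 2, 1]" "exc_pair n \<sigma> = (E, F)"
proof -
  have sub: "E \<subseteq> {1..n}" "F \<subseteq> {1..n}" and card: "card E = card F"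
    and ballot: "\<And>k. k \<in> {1..n} \<Longrightarrow> card {v \<in> F. v \<le> k} \<le> card {i \<in> E. i < k}"
    using assms by (auto simp: ballot_pairs_def)
  have fin: "finite E" "finite F" using sub finite_subset by auto
  define E' F' where "E' = {1..n} - E" and "F' = {1..n} - F"
  obtain f where f: "strict_mono_on E f" "f ` E = F"
    using ex_strict_mono_on[OF fin card] .
  have "card E' = card F'" "finite E'" "finite F'"
    using card sub fin by (auto simp: E'_def F'_def card_Diff_subset)
  then obtain g where g: "strict_mono_on E' g" "g ` E' = F'"
    using ex_strict_mono_on by metis
  define \<sigma> where "\<sigma> i = (if i \<in> E then f i else if i \<in> E' then g i else i)" for i
  have bij: "bij_betw \<sigma> {1..n} {1..n}"
  proof -
    have "bij_betw \<sigma> (E \<union> E') (F \<union> F')"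
    proof (rule bij_betw_combine)
      show "bij_betw \<sigma> E F"
        using f strict_mono_on_imp_inj_on[OF f(1)] unfolding bij_betw_def inj_on_def \<sigma>_def by auto
      show "bij_betw \<sigma> E' F'"
        using g strict_mono_on_imp_inj_on[OF g(1)] unfolding bij_betw_def inj_on_def \<sigma>_def
        by (auto simp: E'_def)
    qed (auto simp: F'_def)
    moreover have "E \<union> E' = {1..n}" "F \<union> F' = {1..n}" using sub by (auto simp: E'_def F'_def)
    ultimately show ?thesis by simp
  qed
  then have perm: "\<sigma> permutes {1..n}"
    by (rule bij_imp_permutes) (use sub in \<open>auto simp: \<sigma>_def E'_def\<close>)
  have below: "card {x \<in> X. x \<le> k} + card {x \<in> {1..n} - X. x \<le> k} = k"
    if "X \<subseteq> {1..n}" "k \<le> n" for X k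
  proof -
    have "{1..k} = {x \<in> X. x \<le> k} \<union> {x \<in> {1..n} - X. x \<le> k}" using that by auto
    moreover have "finite {x \<in> X. x \<le> k}" "finite {x \<in> {1..n} - X. x \<le> k}" by auto
    moreover have "{x \<in> X. x \<le> k} \<inter> {x \<in> {1..n} - X. x \<le> k} = {}" by auto
    ultimately show ?thesis by (metis card_Un_disjoint card_atLeastAtMost diff_Suc_1)
  qed
  \<comment> \<open>If \<open>f i \<le> i\<close>, the ballot condition at \<open>i\<close> makes
    the rank of \<open>f i\<close> in \<open>F\<close> smaller than that of \<open>i\<close> in
    \<open>E\<close>.\<close>
  have exc: "i < f i" if i: "i \<in> E" for i
  proof (rule ccontr)
    assume "\<not> i < f i"
    then have "card {v \<in> F. v \<le> f i} \<le> card {v \<in> F. v \<le> i}"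
      by (intro card_mono) (use fin in auto)
    also have "\<dots> \<le> card {z \<in> E. z < i}" using ballot i sub by blast
    also have "\<dots> < card {z \<in> E. z \<le> i}"
      by (rule psubset_card_mono) (use fin i in auto)
    also have "\<dots> = card {v \<in> F. v \<le> f i}"
      using card_less_strict_mono_on(2)[OF f(1) i] f(2) by simp
    finally show False by simp
  qed
  \<comment> \<open>Passing to complements turns the ballot condition at \<open>i \<notin> E\<close>
    into the reverse inequality, that \<open>F'\<close> has at least as many elements up to
    \<open>i\<close> as \<open>E'\<close>.\<close>
  have nexc: "g i \<le> i" if i: "i \<in> E'" for i
  proof (rule ccontr)
    assume gt: "\<not> g i \<le> i"
    have in': "i \<in> {1..n}" "i \<notin> E" using i by (auto simp: E'_def)
    have "card {v \<in> F'. v \<le> i} \<le> card {v \<in> F'. v < g i}"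
      by (intro card_mono) (use gt in \<open>auto simp: F'_def\<close>)
    also have "\<dots> = card {z \<in> E'. z < i}"
      using card_less_strict_mono_on(1)[OF g(1) i] g(2) by simp
    also have "\<dots> < card {z \<in> E'. z \<le> i}"
      by (rule psubset_card_mono) (use i in \<open>auto simp: E'_def\<close>)
    finally have "card {v \<in> F'. v \<le> i} < card {z \<in> E'. z \<le> i}" .
    moreover have "{z \<in> E. z \<le> i} = {z \<in> E. z < i}" using in' by (auto simp: le_less)
    ultimately show False
      using below[OF sub(1), of i] below[OF sub(2), of i] ballot[OF in'(1)] in'(1)
      by (simp add: E'_def F'_def)
  qed
  have E: "excedances n \<sigma> = E"
    using exc nexc sub by (force simp: excedances_def \<sigma>_def E'_def)
  have mono: "\<sigma> i < \<sigma> j" if "i \<in> {1..n}" "j \<in> {1..n}" "i < j" "i \<in> E \<longleftrightarrow> j \<in> E" for i j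
    using that strict_mono_onD[OF f(1), of i j] strict_mono_onD[OF g(1), of i j]
    by (auto simp: \<sigma>_def E'_def)
  have "\<sigma> \<in> avoiders n [3, 2, 1]"
    unfolding avoiders_321
  proof (intro conjI perm notI)
    assume "\<exists>i\<in>{1..n}. \<exists>j\<in>{1..n}. \<exists>k\<in>{1..n}. i < j \<and> j < k \<and> \<sigma> k < \<sigma> j \<and> \<sigma> j < \<sigma> i"
    then obtain i j k where "i \<in> {1..n}" "j \<in> {1..n}" "k \<in> {1..n}" "i < j" "j < k"
      "\<sigma> k < \<sigma> j" "\<sigma> j < \<sigma> i" by blast
    \<comment> \<open>Two of the three positions lie on the same side of \<open>E\<close>, where
      \<open>\<sigma>\<close> increases.\<close>
    then show False using mono[of i j] mono[of j k] mono[of i k] by fastforce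
  qed
  moreover have "exc_pair n \<sigma> = (E, F)"
    unfolding exc_pair_def E using f(2) by (auto simp: \<sigma>_def)
  ultimately show thesis using that by blast
qed

lemma bij_betw_exc_pair: "bij_betw (exc_pair n) (avoiders n [3, 2, 1]) (ballot_pairs n 0)"
  unfolding bij_betw_def
proof (intro conjI inj_on_exc_pair equalityI subsetI)
  fix p assume "p \<in> exc_pair n ` avoiders n [3, 2, 1]"
  then show "p \<in> ballot_pairs n 0"
    using exc_pair_in_ballot_pairs by (auto simp: avoiders_def)
next
  fix p assume "p \<in> ballot_pairs n 0"
  then show "p \<in> exc_pair n ` avoiders n [3, 2, 1]"
    by (metis exc_pair_surj image_eqI surj_pair)
qed

lemma sum_avoiders_321:
  "(\<Sum>\<sigma>\<in>avoiders n [3, 2, 1]. monom 1 (cr n \<sigma>)) = transfer n 0"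
proof -
  have "(\<Sum>\<sigma>\<in>avoiders n [3, 2, 1]. monom 1 (cr n \<sigma>)) =
      (\<Sum>\<sigma>\<in>avoiders n [3, 2, 1]. monom (1::int) (gap_sum n (exc_pair n \<sigma>)))"
    by (simp add: gap_sum_exc_pair)
  also have "\<dots> = (\<Sum>p\<in>ballot_pairs n 0. monom 1 (gap_sum n p))"
    by (rule sum.reindex_bij_betw[OF bij_betw_exc_pair])
  also have "\<dots> = transfer n 0"
    by (rule sum_ballot_pairs)
  finally show ?thesis .
qed

theorem mainTheorem1:
  fixes n :: nat
  assumes "n \<ge> 1"
  shows "(\<Sum>\<sigma>\<in>avoiders n [3, 2, 1]. monom (1 :: int) (cr n \<sigma>)) =
           (\<Sum>\<sigma>\<in>avoiders n [1, 3, 2]. monom 1 (cr n \<sigma>)) \<and>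
         (\<Sum>\<sigma>\<in>avoiders n [1, 3, 2]. monom (1 :: int) (cr n \<sigma>)) =
           (\<Sum>\<sigma>\<in>avoiders n [2, 1, 3]. monom 1 (cr n \<sigma>))"
  by (simp only: sum_avoiders_321 sum_avoiders_132 sum_avoiders_213 simp_thms)

end
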